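(* Suppose that $n\ge r\ge 4$ and $t_{r-1}(n)<e\le\binom{n}{2}$ are integers. Then $$N(K_r,G)=h_r^{\ast}(n,e)\quad\text{for every } G\in\mathcal{H}_2^{\ast}(n,e).$$ Also, for every integer $r\ge 4$, there are infinitely many pairs $(n,e)\in\mathbb{N}^2$ with $t_{r-1}(n)<e\le\binom{n}{2}$ such that $\mathcal{H}_2^{\ast}(n,e)\setminus\mathcal{H}_1^{\ast}(n,e)\ne\emptyset$.
   Context: $\mathbb{N}=\{1,2,\dots\}$, $[k]=\{1,\dots,k\}$ and $\binom{X}{s}$ is the set of $s$-element subsets of $X$. Graphs are finite and simple; families of graphs are considered up to isomorphism. An $(n,e)$-graph is a graph with $n$ vertices and $e$ edges. $N(K_r,G)$ is the number of $r$-cliques (complete subgraphs on $r$ vertices) in $G$. $T_s(n)$ is the balanced complete $s$-partite graph on $n$ vertices (part sizes differ by at most one; $T_1(n)$ has no edges) and $t_s(n)$ is its number of edges. $K[A_1,\dots,A_\ell]$ denotes the complete $\ell$-partite graph with parts $A_1,\dots,A_\ell$. Given $n,e\in\mathbb{N}$ with $e\le\binom{n}{2}$, let $k=k(n,e):=\min\{s\in\mathbb{N}\colon t_s(n)\ge e\}$. Let $\bm{a}^{\ast}=(a_1^{\ast},\dots,a_k^{\ast})\in\mathbb{N}^k$ be the unique vector such that $$a_k^{\ast}=\min\{a\in\mathbb{N}\colon a(n-a)+t_{k-1}(n-a)\ge e\},$$ $a_1^{\ast}+\dots+a_{k-1}^{\ast}=n-a_k^{\ast}$ and $a_1^{\ast}\ge\dots\ge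 a_{k-1}^{\ast}\ge a_1^{\ast}-1$. Let $$m^{\ast}:=\sum_{\{i,j\}\in\binom{[k]}{2}}a_i^{\ast}a_j^{\ast}-e,\qquad h_r^{\ast}(n,e):=\sum_{I\in\binom{[k]}{r}}\prod_{i\in I}a_i^{\ast}-m^{\ast}\sum_{I'\in\binom{[k-2]}{r-2}}\prod_{j\in I'}a_j^{\ast}.$$ (One has $m^{\ast}\ge 0$.) Let $T:=K[A_1^{\ast},\dots,A_k^{\ast}]$ where $|A_i^{\ast}|=a_i^{\ast}$ for $i\in[k]$. The family $\mathcal{H}_1^{\ast}(n,e)$ is defined as follows. If $m^{\ast}=0$, take all graphs obtained from $T$ by replacing, for some $i\in[k-1]$, the bipartite graph $T[A_i^{\ast}\cup A_k^{\ast}]$ with an arbitrary triangle-free graph on $A_i^{\ast}\cup A_k^{\ast}$ with $a_i^{\ast}a_k^{\ast}$ edges. If $m^{\ast}>0$, take all graphs obtained from $T$ by replacing $T[A_{k-1}^{\ast}\cup A_k^{\ast}]$ with an arbitrary triangle-free graph on $A_{k-1}^{\ast}\cup A_k^{\ast}$ with $a_{k-1}^{\ast}a_k^{\ast}-m^{\ast}$ edges. The family $\mathcal{H}_2^{\ast}(n,e)$ consists of those graphs in $\mathcal{H}_1^{\ast}(n,e)$ that are $k$-partite, along with the following graphs. Take disjoint sets $A_1,\dots,A_k$ of sizes $a_1^{\ast},\dots,a_k^{\ast}$, respectively, and let $m:=m^{\ast}$. If $m^{\ast}=0$ and $a_1^{\ast}\ge a_k^{\ast}+2$, then also allow the alternative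 $(|A_1|,\dots,|A_k|)=(a_2^{\ast},\dots,a_{k-1}^{\ast},a_1^{\ast}-1,a_k^{\ast}+1)$ and, in this alternative, let $m:=a_1^{\ast}-a_k^{\ast}-1$. Let $I:=\{i\in[k-1]\colon |A_i|=|A_{k-1}|\}$. Take all graphs obtained from $K[A_1,\dots,A_k]$ by removing any $m$ edges, each connecting $B_i$ to $A_i$ for some $i\in I$, where $\{B_i\colon i\in I\}$ are some pairwise disjoint subsets of $A_k$. *)

theory Defs
  imports Complex_Main "HOL-Library.Ramsey" "HOL-Library.Disjoint_Sets"
begin

section \<open>Finite simple graphs\<close>

text \<open>A graph is a pair (vertex set, edge set), where an edge is a two-element set of vertices.
  The notation \<open>[X]\<^bsup>s\<^esup>\<close> is the library's \<open>nsets\<close>, the set of \<open>s\<close>-element subsets of \<open>X\<close>.\<close>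

type_synonym 'a ugraph = "'a set \<times> 'a set set"

abbreviation vertices :: "'a ugraph \<Rightarrow> 'a set" where "vertices \<equiv> fst"
abbreviation edges :: "'a ugraph \<Rightarrow> 'a set set" where "edges \<equiv> snd"

definition simple_graph :: "'a ugraph \<Rightarrow> bool" where
  "simple_graph G \<longleftrightarrow> finite (vertices G) \<and> edges G \<subseteq> [vertices G]\<^bsup>2\<^esup>"

definition cliques :: "nat \<Rightarrow> 'a ugraph \<Rightarrow> 'a set set" where
  "cliques r G = {S \<in> [vertices G]\<^bsup>r\<^esup>. [S]\<^bsup>2\<^esup> \<subseteq> edges G}"

definition clique_count :: "nat \<Rightarrow> 'a ugraph \<Rightarrow> nat" where
  "clique_count r G = card (cliques r G)"

definition triangle_free :: "'a ugraph \<Rightarrow> bool" where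
  "triangle_free G \<longleftrightarrow> cliques 3 G = {}"

text \<open>The complete \<open>l\<close>-partite graph \<open>K[A\<^sub>1,\<dots>,A\<^sub>l]\<close>.\<close>

definition complete_multipartite :: "nat \<Rightarrow> (nat \<Rightarrow> 'a set) \<Rightarrow> 'a ugraph" where
  "complete_multipartite l A =
     ((\<Union>i\<in>{1..l}. A i),
      {{x, y} |x y. \<exists>i\<in>{1..l}. \<exists>j\<in>{1..l}. i \<noteq> j \<and> x \<in> A i \<and> y \<in> A j})"

text \<open>Parts may be empty, as usual for "\<open>l\<close>-partite".\<close>

definition multipartite :: "nat \<Rightarrow> 'a ugraph \<Rightarrow> bool" where
  "multipartite l G \<longleftrightarrow>
     (\<exists>A. (\<Union>i\<in>{1..l}. A i) = vertices G \<and> disjoint_family_on A {1..l} \<and>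
          (\<forall>i\<in>{1..l}. \<forall>x\<in>A i. \<forall>y\<in>A i. {x, y} \<notin> edges G))"

text \<open>Residue classes modulo \<open>s\<close> realise the balanced parts of \<open>T\<^sub>s(n)\<close>, for \<open>s \<ge> 1\<close>.\<close>

definition turan_graph :: "nat \<Rightarrow> nat \<Rightarrow> nat ugraph" where
  "turan_graph s n = complete_multipartite s (\<lambda>i. {v. v < n \<and> v mod s + 1 = i})"

definition turan_number :: "nat \<Rightarrow> nat \<Rightarrow> nat" where
  "turan_number s n = card (edges (turan_graph s n))"

text \<open>\<open>replace_on G U F\<close> replaces the induced subgraph \<open>G[U]\<close> by the graph \<open>F\<close> on \<open>U\<close>.\<close>

definition replace_on :: "'a ugraph \<Rightarrow> 'a set \<Rightarrow> 'a ugraph \<Rightarrow> 'a ugraph" where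
  "replace_on G U F = (vertices G, {d \<in> edges G. \<not> d \<subseteq> U} \<union> edges F)"


section \<open>The parameters \<open>k\<close>, \<open>a\<^sup>*\<close>, \<open>m\<^sup>*\<close> and \<open>h\<^sup>*\<close>\<close>

definition k_of :: "nat \<Rightarrow> nat \<Rightarrow> nat" where
  "k_of n e = (LEAST s. 1 \<le> s \<and> e \<le> turan_number s n)"

text \<open>A vector indexed by \<open>{1..k}\<close> is a function on \<open>nat\<close> that vanishes outside \<open>{1..k}\<close>,
  which makes it unique as a function.\<close>

definition is_astar :: "nat \<Rightarrow> nat \<Rightarrow> (nat \<Rightarrow> nat) \<Rightarrow> bool" where
  "is_astar n e a \<longleftrightarrow>
     (let k = k_of n e in
        (\<forall>i. i \<notin> {1..k} \<longrightarrow> a i = 0) \<and>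
        (\<forall>i\<in>{1..k}. 1 \<le> a i) \<and>
        a k = (LEAST b. 1 \<le> b \<and> b \<le> n \<and> e \<le> b * (n - b) + turan_number (k - 1) (n - b)) \<and>
        (\<Sum>i=1..k-1. a i) = n - a k \<and>
        (\<forall>i\<in>{1..k-1}. \<forall>j\<in>{1..k-1}. i \<le> j \<longrightarrow> a j \<le> a i) \<and>
        a 1 \<le> a (k - 1) + 1)"

definition astar :: "nat \<Rightarrow> nat \<Rightarrow> nat \<Rightarrow> nat" where
  "astar n e = (THE a. is_astar n e a)"

definition mstar :: "nat \<Rightarrow> nat \<Rightarrow> int" where
  "mstar n e = (\<Sum>I\<in>[{1..k_of n e}]\<^bsup>2\<^esup>. \<Prod>i\<in>I. int (astar n e i)) - int e"

definition hstar :: "nat \<Rightarrow> nat \<Rightarrow> nat \<Rightarrow> int" where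
  "hstar r n e =
     (\<Sum>I\<in>[{1..k_of n e}]\<^bsup>r\<^esup>. \<Prod>i\<in>I. int (astar n e i))
     - mstar n e * (\<Sum>J\<in>[{1..k_of n e - 2}]\<^bsup>(r - 2)\<^esup>. \<Prod>j\<in>J. int (astar n e j))"


section \<open>The families \<open>H\<^sub>1\<^sup>*\<close> and \<open>H\<^sub>2\<^sup>*\<close>\<close>

definition parts_of_sizes :: "nat \<Rightarrow> (nat \<Rightarrow> nat) \<Rightarrow> (nat \<Rightarrow> 'a set) \<Rightarrow> bool" where
  "parts_of_sizes k a A \<longleftrightarrow>
     disjoint_family_on A {1..k} \<and> (\<forall>i\<in>{1..k}. finite (A i) \<and> card (A i) = a i)"

text \<open>The parts range over all disjoint sets of the prescribed sizes, so both families below are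
  closed under isomorphism within the vertex type \<open>'a\<close>. In particular, if \<open>'a\<close> is infinite, their
  set difference agrees with the difference taken up to isomorphism.\<close>

definition H1star :: "nat \<Rightarrow> nat \<Rightarrow> 'a ugraph set" where
  "H1star n e = {G. \<exists>A.
     let k = k_of n e; a = astar n e; T = complete_multipartite k A in
       parts_of_sizes k a A \<and>
       ((mstar n e = 0 \<and>
         (\<exists>i\<in>{1..k-1}. \<exists>F. simple_graph F \<and> vertices F = A i \<union> A k \<and> triangle_free F \<and>
            card (edges F) = a i * a k \<and>
            G = replace_on T (A i \<union> A k) F)) \<or>
        (mstar n e > 0 \<and>
         (\<exists>F. simple_graph F \<and> vertices F = A (k-1) \<union> A k \<and> triangle_free F \<and>
            int (card (edges F)) = int (a (k-1) * a k) - mstar n e \<and>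
            G = replace_on T (A (k-1) \<union> A k) F)))}"

text \<open>The alternative size vector \<open>(a\<^sub>2,\<dots>,a\<^sub>k\<^sub>-\<^sub>1,a\<^sub>1-1,a\<^sub>k+1)\<close>.\<close>

definition alt_sizes :: "nat \<Rightarrow> (nat \<Rightarrow> nat) \<Rightarrow> nat \<Rightarrow> nat" where
  "alt_sizes k a i =
     (if i = k then a k + 1 else if i = k - 1 then a 1 - 1 else a (i + 1))"

definition H2_removal :: "nat \<Rightarrow> nat \<Rightarrow> 'a ugraph set" where
  "H2_removal n e = {G. \<exists>A m B R.
     let k = k_of n e; a = astar n e; I = {i\<in>{1..k-1}. card (A i) = card (A (k-1))} in
       ((parts_of_sizes k a A \<and> m = mstar n e) \<or>
        (mstar n e = 0 \<and> a 1 \<ge> a k + 2 \<and>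
         parts_of_sizes k (alt_sizes k a) A \<and> m = int (a 1) - int (a k) - 1)) \<and>
       (\<forall>i\<in>I. B i \<subseteq> A k) \<and> disjoint_family_on B I \<and>
       R \<subseteq> {{x, y} |x y. \<exists>i\<in>I. x \<in> B i \<and> y \<in> A i} \<and> int (card R) = m \<and>
       G = (vertices (complete_multipartite k A), edges (complete_multipartite k A) - R)}"

definition H2star :: "nat \<Rightarrow> nat \<Rightarrow> 'a ugraph set" where
  "H2star n e = {G \<in> H1star n e. multipartite (k_of n e) G} \<union> H2_removal n e"

end

theory Submission
  imports Defs
begin

text \<open>Every clique of a complete multipartite graph is a transversal of some of the parts, so cliques
  are counted by elementary symmetric polynomials of the part sizes. Replacing \<open>T[A\<^sub>i \<union> A\<^sub>k]\<close> by a
  triangle-free graph that is short of \<open>m\<close> edges, or deleting \<open>m\<close> edges between \<open>A\<^sub>k\<close> and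
  parts \<open>A\<^sub>i\<close> of the same size as \<open>A\<^sub>k\<^sub>-\<^sub>1\<close>, costs exactly \<open>m\<close> times the number of \<open>(r-2)\<close>-cliques of
  the remaining \<open>k - 2\<close> parts. In the second case this holds because the sets \<open>B\<^sub>i\<close> are disjoint,
  so that a transversal contains at most one deleted edge. Moving one vertex from \<open>A\<^sub>1\<close> to \<open>A\<^sub>k\<close>
  gains \<open>a\<^sub>1 - a\<^sub>k - 1\<close> edges between them, which the deletion of as many edges cancels.

  For the second claim, take \<open>k = r\<close>, \<open>k - 1\<close> parts of size \<open>c + k\<close> and a last part of size \<open>c \<ge> 2\<close>,
  and delete one edge at \<open>A\<^sub>1\<close> and one at \<open>A\<^sub>2\<close> with distinct ends in \<open>A\<^sub>k\<close>. Then
  \<open>A\<^sub>1 \<union> A\<^sub>2 \<union> A\<^sub>k\<close> is connected in the complement. In a graph of \<open>H\<^sub>1\<^sup>*\<close> with \<open>m\<^sup>* > 0\<close> each of the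
  first \<open>k - 2\<close> parts is complete to its outside, so this set would have to lie inside one of these parts
  or inside the union of the last two, and it is too large for either.\<close>

section \<open>Elementary symmetric polynomials\<close>

text \<open>This is the elementary symmetric polynomial of degree \<open>r\<close>; the sums in
  \<open>mstar\<close> and \<open>hstar\<close> are its instances over the integers. An arbitrary
  index set makes it possible to split off single parts.\<close>

definition esym :: "('i \<Rightarrow> 'b::comm_ring_1) \<Rightarrow> 'i set \<Rightarrow> nat \<Rightarrow> 'b" where
  "esym a X r = (\<Sum>I\<in>[X]\<^bsup>r\<^esup>. \<Prod>i\<in>I. a i)"

lemma esym_0 [simp]: "esym a X 0 = 1"
  by (simp add: esym_def)

lemma esym_empty_Suc [simp]: "esym a {} (Suc r) = 0"
  by (simp add: esym_def nsets_empty_iff)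

lemma nsets_insert_Suc:
  assumes "j \<notin> X"
  shows "[insert j X]\<^bsup>Suc r\<^esup> = [X]\<^bsup>Suc r\<^esup> \<union> insert j ` [X]\<^bsup>r\<^esup>"
proof (intro equalityI subsetI)
  fix S assume S: "S \<in> [insert j X]\<^bsup>Suc r\<^esup>"
  show "S \<in> [X]\<^bsup>Suc r\<^esup> \<union> insert j ` [X]\<^bsup>r\<^esup>"
  proof (cases "j \<in> S")
    case True
    then have "S = insert j (S - {j})" "S - {j} \<in> [X]\<^bsup>r\<^esup>"
      using S by (auto simp: nsets_def)
    then show ?thesis by blast
  qed (use S in \<open>auto simp: nsets_def\<close>)
next
  fix S assume "S \<in> [X]\<^bsup>Suc r\<^esup> \<union> insert j ` [X]\<^bsup>r\<^esup>"
  then show "S \<in> [insert j X]\<^bsup>Suc r\<^esup>"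
  proof
    assume "S \<in> insert j ` [X]\<^bsup>r\<^esup>"
    then obtain T where "S = insert j T" "T \<in> [X]\<^bsup>r\<^esup>" by blast
    moreover have "j \<notin> T" using assms calculation by (auto simp: nsets_def)
    ultimately show ?thesis by (auto simp: nsets_def)
  qed (auto simp: nsets_def)
qed

text \<open>The index sets are sorted by whether they contain \<open>j\<close>. This recursion
  drives the inductions on \<open>esym\<close> below.\<close>

lemma esym_insert_Suc:
  assumes X: "finite X" and j: "j \<notin> X"
  shows "esym a (insert j X) (Suc r) = esym a X (Suc r) + a j * esym a X r"
proof -
  have inj: "inj_on (insert j) ([X]\<^bsup>r\<^esup>)"
    using j by (auto simp: inj_on_def nsets_def)
  have "(\<Prod>i\<in>insert j T. a i) = a j * (\<Prod>i\<in>T. a i)" if "T \<in> [X]\<^bsup>r\<^esup>" for T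
    using that j by (subst prod.insert) (auto simp: nsets_def)
  then have "(\<Sum>I\<in>insert j ` [X]\<^bsup>r\<^esup>. \<Prod>i\<in>I. a i) = a j * esym a X r"
    by (simp add: sum.reindex[OF inj] esym_def sum_distrib_left)
  moreover have "[X]\<^bsup>Suc r\<^esup> \<inter> insert j ` [X]\<^bsup>r\<^esup> = {}"
    using j by (auto simp: nsets_def)
  ultimately show ?thesis
    unfolding esym_def nsets_insert_Suc[OF j]
    by (subst sum.union_disjoint) (auto simp: X finite_imp_finite_nsets esym_def)
qed

lemma esym_cong:
  assumes "\<And>i. i \<in> X \<Longrightarrow> a i = b i"
  shows "esym a X r = esym b X r"
  unfolding esym_def using assms by (intro sum.cong prod.cong) (auto simp: nsets_def)

lemma esym_1: "finite X \<Longrightarrow> esym a X 1 = (\<Sum>i\<in>X. a i)"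
  by (induction X rule: finite_induct) (simp_all add: esym_insert_Suc[where r = 0, simplified])

text \<open>Expanding the square separates diagonal from mixed products. Edge counts thereby turn
  into sums of squares of part sizes, the form used in all later estimates.\<close>

lemma esym_2:
  assumes "finite X"
  shows "2 * esym a X 2 + (\<Sum>i\<in>X. (a i)\<^sup>2) = (\<Sum>i\<in>X. a i)\<^sup>2"
  using assms
proof (induction X rule: finite_induct)
  case empty
  then show ?case by (simp add: numeral_2_eq_2)
next
  case (insert x X)
  then have "esym a (insert x X) 2 = esym a X 2 + a x * (\<Sum>i\<in>X. a i)"
    using esym_insert_Suc[of X x a 1] esym_1[of X a] by (simp add: numeral_2_eq_2)
  then show ?case
    using insert by (simp add: algebra_simps power2_sum flip: insert.IH)
qed

lemma esym_reindex:
  assumes "finite X" "inj_on f X"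
  shows "esym (\<lambda>i. a (f i)) X r = esym a (f ` X) r"
  using assms
proof (induction X arbitrary: r rule: finite_induct)
  case empty
  then show ?case by (cases r) auto
next
  case (insert x X)
  then show ?case by (cases r) (auto simp: esym_insert_Suc)
qed

text \<open>Degree by degree, the recursion determines the polynomial of \<open>X - {x}\<close> from
  that of \<open>X\<close> and the value \<open>a x\<close> alone. This lets any part of the same
  size stand in for part \<open>k - 1\<close>.\<close>

lemma esym_remove_eq:
  assumes X: "finite X" and ij: "i \<in> X" "j \<in> X" "a i = a j"
  shows "esym a (X - {i}) r = esym a (X - {j}) r"
proof (induction r)
  case (Suc r)
  have "esym a X (Suc r) = esym a (X - {x}) (Suc r) + a x * esym a (X - {x}) r" if "x \<in> X" for x
    using esym_insert_Suc[of "X - {x}" x a r] X that by (simp add: insert_absorb)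
  from this[OF ij(1)] this[OF ij(2)] show ?case
    using Suc ij(3) by simp
qed simp

lemma esym_insert2:
  assumes "finite X" "i \<notin> X" "j \<notin> X" "i \<noteq> j"
  shows "esym a (insert i (insert j X)) (Suc (Suc r)) =
           esym a X (Suc (Suc r)) + (a i + a j) * esym a X (Suc r) + a i * a j * esym a X r"
  using assms by (simp add: esym_insert_Suc algebra_simps)

section \<open>Counting cliques\<close>

text \<open>A set in a disjoint union is determined by its two traces, and the conditions on them
  are independent, so the counts form a convolution over the size \<open>j\<close> of the trace on
  \<open>U\<close>.\<close>

lemma card_nsets_union:
  assumes W: "finite W" and U: "finite U" and WU: "W \<inter> U = {}"
  shows "card {S \<in> [W \<union> U]\<^bsup>r\<^esup>. S \<inter> W \<in> P \<and> S \<inter> U \<in> Q} =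
           (\<Sum>j\<le>r. card (P \<inter> [W]\<^bsup>(r - j)\<^esup>) * card (Q \<inter> [U]\<^bsup>j\<^esup>))"
proof -
  let ?D = "\<lambda>j. (P \<inter> [W]\<^bsup>(r - j)\<^esup>) \<times> (Q \<inter> [U]\<^bsup>j\<^esup>)"
  let ?M = "{S \<in> [W \<union> U]\<^bsup>r\<^esup>. S \<inter> W \<in> P \<and> S \<inter> U \<in> Q}"
  have "bij_betw (\<lambda>S. (S \<inter> W, S \<inter> U)) ?M (\<Union>j\<le>r. ?D j)"
  proof (rule bij_betw_byWitness[where f' = "\<lambda>(S, T). S \<union> T"])
    show "\<forall>S\<in>?M. (\<lambda>(S, T). S \<union> T) (S \<inter> W, S \<inter> U) = S"
      by (auto simp: nsets_def)
    show "\<forall>D\<in>\<Union>j\<le>r. ?D j. ((case D of (S, T) \<Rightarrow> S \<union> T) \<inter> W, (case D of (S, T) \<Rightarrow> S \<union> T) \<inter> U) = D"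
      using WU by (auto simp: nsets_def)
    show "(\<lambda>S. (S \<inter> W, S \<inter> U)) ` ?M \<subseteq> (\<Union>j\<le>r. ?D j)"
    proof clarify
      fix S assume S: "S \<in> [W \<union> U]\<^bsup>r\<^esup>" "S \<inter> W \<in> P" "S \<inter> U \<in> Q"
      have "card ((S \<inter> W) \<union> (S \<inter> U)) = card (S \<inter> W) + card (S \<inter> U)"
        using W U WU by (intro card_Un_disjoint) auto
      moreover have "(S \<inter> W) \<union> (S \<inter> U) = S" using S(1) by (auto simp: nsets_def)
      ultimately have "card (S \<inter> W) = r - card (S \<inter> U)" "card (S \<inter> U) \<le> r"
        using S(1) by (auto simp: nsets_def)
      then show "(S \<inter> W, S \<inter> U) \<in> (\<Union>j\<le>r. ?D j)"
        using S W U by (auto simp: nsets_def)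
    qed
    show "(\<lambda>(S, T). S \<union> T) ` (\<Union>j\<le>r. ?D j) \<subseteq> ?M"
    proof clarify
      fix j S T
      assume j: "j \<le> r" and S: "S \<in> P" "S \<in> [W]\<^bsup>(r - j)\<^esup>" and T: "T \<in> Q" "T \<in> [U]\<^bsup>j\<^esup>"
      have "S \<subseteq> W" "T \<subseteq> U" using S T by (auto simp: nsets_def)
      then have "(S \<union> T) \<inter> W = S" "(S \<union> T) \<inter> U = T" "S \<inter> T = {}" using WU by auto
      moreover have "S \<union> T \<in> [W \<union> U]\<^bsup>r\<^esup>"
        using \<open>S \<inter> T = {}\<close> S T j by (auto simp: nsets_def card_Un_disjoint)
      ultimately show "S \<union> T \<in> [W \<union> U]\<^bsup>r\<^esup> \<and> (S \<union> T) \<inter> W \<in> P \<and> (S \<union> T) \<inter> U \<in> Q"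
        using S T by simp
    qed
  qed
  then have "card ?M = card (\<Union>j\<le>r. ?D j)"
    by (rule bij_betw_same_card)
  also have "\<dots> = (\<Sum>j\<le>r. card (?D j))"
    using W U by (intro card_UN_disjoint) (auto simp: finite_imp_finite_nsets nsets_def)
  finally show ?thesis by (simp add: card_cartesian_product)
qed

lemma card_Int_le_1_iff:
  assumes "finite S"
  shows "card (S \<inter> B) \<le> 1 \<longleftrightarrow> (\<forall>x\<in>S \<inter> B. \<forall>y\<in>S \<inter> B. x = y)"
  using card_le_Suc0_iff_eq[of "S \<inter> B"] assms by simp

lemma cliques_2:
  assumes "edges G \<subseteq> [vertices G]\<^bsup>2\<^esup>"
  shows "cliques 2 G = edges G"
proof -
  have "[d]\<^bsup>2\<^esup> = {d}" if "d \<in> [vertices G]\<^bsup>2\<^esup>" for d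
    using that by (auto simp: nsets_2_eq)
  then show ?thesis
    using assms by (auto simp: cliques_def)
qed

text \<open>These are partial transversals: parts may be missed, and \<open>r\<close> fixes the
  number of points chosen.\<close>

definition transversals :: "nat \<Rightarrow> 'i set \<Rightarrow> ('i \<Rightarrow> 'a set) \<Rightarrow> 'a set set" where
  "transversals r X A = {S \<in> [\<Union>i\<in>X. A i]\<^bsup>r\<^esup>. \<forall>i\<in>X. card (S \<inter> A i) \<le> 1}"

text \<open>The block \<open>U\<close> carries a free condition \<open>Q\<close>. It will be one
  further part, a pair of parts with a replaced graph, or a pair of parts in which one edge is
  prescribed.\<close>

lemma card_transversals_union:
  assumes fin: "\<And>i. i \<in> X \<Longrightarrow> finite (A i)" and X: "finite X"
    and U: "finite U" and AU: "\<And>i. i \<in> X \<Longrightarrow> A i \<inter> U = {}"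
  shows "card {S \<in> [(\<Union>i\<in>X. A i) \<union> U]\<^bsup>r\<^esup>. (\<forall>i\<in>X. card (S \<inter> A i) \<le> 1) \<and> S \<inter> U \<in> Q} =
           (\<Sum>j\<le>r. card (transversals (r - j) X A) * card (Q \<inter> [U]\<^bsup>j\<^esup>))"
proof -
  let ?W = "\<Union>i\<in>X. A i" and ?P = "{S. \<forall>i\<in>X. card (S \<inter> A i) \<le> 1}"
  have "S \<inter> ?W \<inter> A i = S \<inter> A i" if "i \<in> X" for S i
    using that by auto
  then have "{S \<in> [?W \<union> U]\<^bsup>r\<^esup>. (\<forall>i\<in>X. card (S \<inter> A i) \<le> 1) \<and> S \<inter> U \<in> Q} =
        {S \<in> [?W \<union> U]\<^bsup>r\<^esup>. S \<inter> ?W \<in> ?P \<and> S \<inter> U \<in> Q}"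
    by auto
  moreover have "?P \<inter> [?W]\<^bsup>s\<^esup> = transversals s X A" for s
    by (auto simp: transversals_def)
  moreover have "?W \<inter> U = {}" "finite ?W" using AU fin X by blast+
  ultimately show ?thesis
    using card_nsets_union[of ?W U r ?P Q] U by simp
qed

text \<open>Adding a part contributes either no point or one of its points, which matches the
  recursion of \<open>esym\<close>.\<close>

lemma card_transversals:
  assumes "finite X" "disjoint_family_on A X" "\<And>i. i \<in> X \<Longrightarrow> finite (A i)"
  shows "int (card (transversals r X A)) = esym (\<lambda>i. int (card (A i))) X r"
  using assms
proof (induction X arbitrary: r rule: finite_induct)
  case empty
  have "transversals r {} A = (if r = 0 then {{}} else {})"
    by (simp add: transversals_def nsets_empty_iff)
  then show ?case by (cases r) auto
next
  case (insert x X)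
  let ?Q = "{S. card S \<le> 1}"
  have IH: "int (card (transversals s X A)) = esym (\<lambda>i. int (card (A i))) X s" for s
    using insert.prems by (intro insert.IH) (auto simp: disjoint_family_on_def)
  show ?case
  proof (cases r)
    case 0
    have "transversals 0 (insert x X) A = {{}}"
      by (auto simp: transversals_def)
    then show ?thesis by (simp add: 0)
  next
    case (Suc s)
    have "card (?Q \<inter> [A x]\<^bsup>j\<^esup>) = (if j = 0 then 1 else if j = 1 then card (A x) else 0)" for j
    proof -
      consider "j = 0" | "j = 1" | "j > 1" by linarith
      then show ?thesis
      proof cases
        case 1
        have "?Q \<inter> {{}} = {{}}" by auto
        then show ?thesis using 1 by simp
      next
        case 2
        have "?Q \<inter> [A x]\<^bsup>1\<^esup> = (\<lambda>y. {y}) ` A x"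
          by (auto simp: nsets_one)
        then show ?thesis using 2 by (simp add: card_image)
      next
        case 3
        then have "?Q \<inter> [A x]\<^bsup>j\<^esup> = {}" by (auto simp: nsets_def)
        then show ?thesis using 3 by simp
      qed
    qed
    note Q = this
    have "transversals r (insert x X) A =
        {S \<in> [(\<Union>i\<in>X. A i) \<union> A x]\<^bsup>r\<^esup>. (\<forall>i\<in>X. card (S \<inter> A i) \<le> 1) \<and> S \<inter> A x \<in> ?Q}"
      by (auto simp: transversals_def Un_commute)
    also have "card \<dots> = (\<Sum>j\<le>r. card (transversals (r - j) X A) * card (?Q \<inter> [A x]\<^bsup>j\<^esup>))"
      using insert.prems insert.hyps by (intro card_transversals_union) (auto simp: disjoint_family_on_def)
    \<comment> \<open>Since \<open>r\<close> is a successor here, both 0 and 1 lie in the summation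
      range.\<close>
    also have "\<dots> = (\<Sum>j\<in>{0, 1}. card (transversals (r - j) X A) * card (?Q \<inter> [A x]\<^bsup>j\<^esup>))"
      using Suc by (intro sum.mono_neutral_right) (auto simp: Q simp del: One_nat_def)
    also have "\<dots> = card (transversals (Suc s) X A) + card (A x) * card (transversals s X A)"
      using Suc by (simp only: Q) simp
    finally show ?thesis
      using insert.hyps by (simp add: IH esym_insert_Suc Suc)
  qed
qed

section \<open>Cliques of complete multipartite graphs\<close>

lemma edge_complete_multipartite_iff:
  assumes "disjoint_family_on A {1..l}" "i \<in> {1..l}" "j \<in> {1..l}" "x \<in> A i" "y \<in> A j"
  shows "{x, y} \<in> edges (complete_multipartite l A) \<longleftrightarrow> i \<noteq> j"
proof
  assume "{x, y} \<in> edges (complete_multipartite l A)"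
  then obtain u v i' j' where *: "{x, y} = {u, v}" "i' \<in> {1..l}" "j' \<in> {1..l}" "i' \<noteq> j'"
    "u \<in> A i'" "v \<in> A j'"
    unfolding complete_multipartite_def by auto
  have "p = q" if "p \<in> {1..l}" "q \<in> {1..l}" "z \<in> A p" "z \<in> A q" for p q z
    using that assms(1) unfolding disjoint_family_on_def by blast
  then show "i \<noteq> j"
    using * assms unfolding doubleton_eq_iff by metis
next
  assume "i \<noteq> j"
  then show "{x, y} \<in> edges (complete_multipartite l A)"
    unfolding complete_multipartite_def snd_conv mem_Collect_eq
    using assms by (intro exI[of _ x] exI[of _ y]) blast
qed

lemma vertices_complete_multipartite [simp]:
  "vertices (complete_multipartite l A) = (\<Union>i\<in>{1..l}. A i)"
  by (simp add: complete_multipartite_def)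

lemma edges_complete_multipartite_subset:
  assumes "disjoint_family_on A {1..l}"
  shows "edges (complete_multipartite l A) \<subseteq> [\<Union>i\<in>{1..l}. A i]\<^bsup>2\<^esup>"
proof
  fix d assume "d \<in> edges (complete_multipartite l A)"
  then obtain u v i j where *: "d = {u, v}" "i \<in> {1..l}" "j \<in> {1..l}" "i \<noteq> j"
    "u \<in> A i" "v \<in> A j"
    unfolding complete_multipartite_def by auto
  then have "u \<noteq> v" using assms unfolding disjoint_family_on_def by blast
  then show "d \<in> [\<Union>i\<in>{1..l}. A i]\<^bsup>2\<^esup>" using * by auto
qed

lemma cliques_complete_multipartite:
  assumes "disjoint_family_on A {1..l}"
  shows "cliques r (complete_multipartite l A) = transversals r {1..l} A"
proof -
  have "[S]\<^bsup>2\<^esup> \<subseteq> edges (complete_multipartite l A) \<longleftrightarrow> (\<forall>i\<in>{1..l}. card (S \<inter> A i) \<le> 1)"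
    if S: "S \<in> [\<Union>i\<in>{1..l}. A i]\<^bsup>r\<^esup>" for S
  proof -
    have finS: "finite S" and SV: "S \<subseteq> (\<Union>i\<in>{1..l}. A i)"
      using S by (auto simp: nsets_def)
    show ?thesis
    proof
      assume E: "[S]\<^bsup>2\<^esup> \<subseteq> edges (complete_multipartite l A)"
      show "\<forall>i\<in>{1..l}. card (S \<inter> A i) \<le> 1"
      proof
        fix i assume i: "i \<in> {1..l}"
        have "x = y" if "x \<in> S \<inter> A i" "y \<in> S \<inter> A i" for x y
        proof (rule ccontr)
          assume "x \<noteq> y"
          then have "{x, y} \<in> [S]\<^bsup>2\<^esup>" using that by simp
          then show False
            using E edge_complete_multipartite_iff[OF assms i i, of x y] that by blast
        qed
        then show "card (S \<inter> A i) \<le> 1"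
          unfolding card_Int_le_1_iff[OF finS] by blast
      qed
    next
      assume T: "\<forall>i\<in>{1..l}. card (S \<inter> A i) \<le> 1"
      show "[S]\<^bsup>2\<^esup> \<subseteq> edges (complete_multipartite l A)"
      proof
        fix d assume "d \<in> [S]\<^bsup>2\<^esup>"
        then obtain x y where d: "d = {x, y}" "x \<in> S" "y \<in> S" "x \<noteq> y"
          by (auto simp: nsets_2_eq)
        then obtain i j where ij: "i \<in> {1..l}" "j \<in> {1..l}" "x \<in> A i" "y \<in> A j"
          using d SV by blast
        have "i \<noteq> j"
          using T[rule_format, OF ij(1), unfolded card_Int_le_1_iff[OF finS]] d ij by blast
        then show "d \<in> edges (complete_multipartite l A)"
          using edge_complete_multipartite_iff[OF assms ij] d by simp
      qed
    qed
  qed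
  then show ?thesis
    unfolding cliques_def transversals_def by auto
qed

text \<open>Edges are the 2-cliques, so this is the transversal count in degree 2.\<close>

lemma card_edges_complete_multipartite:
  assumes "disjoint_family_on A {1..l}" "\<And>i. i \<in> {1..l} \<Longrightarrow> finite (A i)"
  shows "int (card (edges (complete_multipartite l A))) = esym (\<lambda>i. int (card (A i))) {1..l} 2"
proof -
  have "cliques 2 (complete_multipartite l A) = edges (complete_multipartite l A)"
    using edges_complete_multipartite_subset[OF assms(1)] by (intro cliques_2) simp
  then show ?thesis
    using card_transversals[of "{1..l}" A 2] assms
    by (simp add: cliques_complete_multipartite)
qed

section \<open>Effect of replacing or deleting edges on the clique count\<close>

lemma card_cliques_triangle_free:
  assumes "simple_graph F" "triangle_free F"
  shows "card (cliques j F) =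
    (if j = 0 then 1 else if j = 1 then card (vertices F) else if j = 2 then card (edges F) else 0)"
proof -
  have F: "finite (vertices F)" "edges F \<subseteq> [vertices F]\<^bsup>2\<^esup>"
    using assms(1) by (auto simp: simple_graph_def)
  consider "j = 0" | "j = 1" | "j = 2" | "j \<ge> 3" by linarith
  then show ?thesis
  proof cases
    case 1
    have "[{}]\<^bsup>2\<^esup> = ({} :: 'a set set)" by (auto simp: nsets_def)
    then have "cliques 0 F = {{}}" by (auto simp: cliques_def)
    then show ?thesis using 1 by simp
  next
    case 2
    have "cliques 1 F = (\<lambda>y. {y}) ` vertices F"
      by (auto simp: cliques_def nsets_one nsets_2_eq)
    then show ?thesis using 2 by (simp add: card_image)
  next
    case 3
    show ?thesis using 3 cliques_2[OF F(2)] by simp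
  next
    case 4
    \<comment> \<open>Any three vertices of a larger clique would span a triangle.\<close>
    have "cliques j F = {}"
    proof (rule ccontr)
      assume "cliques j F \<noteq> {}"
      then obtain S where S: "S \<in> [vertices F]\<^bsup>j\<^esup>" "[S]\<^bsup>2\<^esup> \<subseteq> edges F"
        by (auto simp: cliques_def)
      then obtain T where T: "T \<subseteq> S" "card T = 3" "finite T"
        using 4 obtain_subset_with_card_n[of 3 S] by (auto simp: nsets_def)
      have "T \<in> cliques 3 F"
        using S T nsets_mono[OF T(1), of 2] by (auto simp: cliques_def nsets_def)
      then show False using assms(2) by (auto simp: triangle_free_def)
    qed
    then show ?thesis using 4 by simp
  qed
qed

text \<open>Pairs not inside \<open>A p \<union> A q\<close> keep their adjacency, so a clique
  consists of a clique of \<open>F\<close> and a transversal of the untouched parts, chosen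
  independently.\<close>

lemma cliques_replace_on:
  assumes A: "disjoint_family_on A {1..l}"
    and pq: "p \<in> {1..l}" "q \<in> {1..l}" "p \<noteq> q"
    and F: "simple_graph F" "vertices F = A p \<union> A q"
  shows "cliques r (replace_on (complete_multipartite l A) (A p \<union> A q) F) =
    {S \<in> [(\<Union>i\<in>{1..l} - {p, q}. A i) \<union> (A p \<union> A q)]\<^bsup>r\<^esup>.
       (\<forall>i\<in>{1..l} - {p, q}. card (S \<inter> A i) \<le> 1) \<and> S \<inter> (A p \<union> A q) \<in> {T. [T]\<^bsup>2\<^esup> \<subseteq> edges F}}"
    (is "_ = ?M")
proof -
  let ?K = "complete_multipartite l A" and ?U = "A p \<union> A q" and ?X = "{1..l} - {p, q}"
  let ?G = "replace_on ?K ?U F"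
  have V: "(\<Union>i\<in>{1..l}. A i) = (\<Union>i\<in>?X. A i) \<union> ?U"
    using pq by auto
  have FU: "d \<subseteq> ?U" if "d \<in> edges F" for d
    using F that by (auto simp: simple_graph_def nsets_def)
  have "[S]\<^bsup>2\<^esup> \<subseteq> edges ?G \<longleftrightarrow> (\<forall>i\<in>?X. card (S \<inter> A i) \<le> 1) \<and> [S \<inter> ?U]\<^bsup>2\<^esup> \<subseteq> edges F"
    if S: "S \<in> [\<Union>i\<in>{1..l}. A i]\<^bsup>r\<^esup>" for S
  proof -
    have finS: "finite S" and SV: "S \<subseteq> (\<Union>i\<in>{1..l}. A i)"
      using S by (auto simp: nsets_def)
    show ?thesis
    proof
      assume E: "[S]\<^bsup>2\<^esup> \<subseteq> edges ?G"
      have "card (S \<inter> A i) \<le> 1" if i: "i \<in> ?X" for i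
      proof -
        have "x = y" if "x \<in> S \<inter> A i" "y \<in> S \<inter> A i" for x y
        proof (rule ccontr)
          assume "x \<noteq> y"
          then have "{x, y} \<in> [S]\<^bsup>2\<^esup>" using that by simp
          then have "{x, y} \<in> edges ?G" using E by blast
          moreover have "x \<notin> A p" "x \<notin> A q"
            using that i disjoint_family_onD[OF A, of i p] disjoint_family_onD[OF A, of i q] pq
            by auto
          ultimately have "{x, y} \<in> edges ?K" using FU by (auto simp: replace_on_def)
          then show False
            using edge_complete_multipartite_iff[OF A, of i i x y] i that by auto
        qed
        then show ?thesis
          unfolding card_Int_le_1_iff[OF finS] by blast
      qed
      moreover have "[S \<inter> ?U]\<^bsup>2\<^esup> \<subseteq> edges F"
      proof
        fix d assume d: "d \<in> [S \<inter> ?U]\<^bsup>2\<^esup>"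
        then have "d \<in> edges ?G" using E nsets_mono[of "S \<inter> ?U" S 2] by blast
        moreover have "d \<subseteq> ?U" using d by (auto simp: nsets_def)
        ultimately show "d \<in> edges F" by (auto simp: replace_on_def)
      qed
      ultimately show "(\<forall>i\<in>?X. card (S \<inter> A i) \<le> 1) \<and> [S \<inter> ?U]\<^bsup>2\<^esup> \<subseteq> edges F" by blast
    next
      assume R: "(\<forall>i\<in>?X. card (S \<inter> A i) \<le> 1) \<and> [S \<inter> ?U]\<^bsup>2\<^esup> \<subseteq> edges F"
      show "[S]\<^bsup>2\<^esup> \<subseteq> edges ?G"
      proof
        fix d assume "d \<in> [S]\<^bsup>2\<^esup>"
        then obtain x y where d: "d = {x, y}" "x \<in> S" "y \<in> S" "x \<noteq> y"
          by (auto simp: nsets_2_eq)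
        show "d \<in> edges ?G"
        proof (cases "d \<subseteq> ?U")
          case True
          then have "d \<in> [S \<inter> ?U]\<^bsup>2\<^esup>" using d by auto
          then show ?thesis using R by (auto simp: replace_on_def)
        next
          case False
          obtain i j where ij: "i \<in> {1..l}" "j \<in> {1..l}" "x \<in> A i" "y \<in> A j"
            using d SV by blast
          have "i \<noteq> j"
          proof
            assume "i = j"
            then have "i \<in> ?X" using False d ij by auto
            then have "card (S \<inter> A i) \<le> 1" using R by blast
            then show False
              using d ij \<open>i = j\<close> unfolding card_Int_le_1_iff[OF finS] by blast
          qed
          then have "d \<in> edges ?K"
            using edge_complete_multipartite_iff[OF A ij] d by simp
          then show ?thesis using False by (simp add: replace_on_def)
        qed
      qed
    qed
  qed
  then have "cliques r ?G = {S \<in> [\<Union>i\<in>{1..l}. A i]\<^bsup>r\<^esup>.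
      (\<forall>i\<in>?X. card (S \<inter> A i) \<le> 1) \<and> [S \<inter> ?U]\<^bsup>2\<^esup> \<subseteq> edges F}"
    unfolding cliques_def by (auto simp: replace_on_def)
  then show ?thesis unfolding V by auto
qed

text \<open>The triangle-free graph \<open>F\<close> contributes only cliques of sizes 0, 1 and 2.
  The first two counts agree with those of the complete bipartite graph on the same vertices, so
  only the deficit in edges matters, whatever the shape of \<open>F\<close>.\<close>

lemma clique_count_replace_on:
  assumes A: "disjoint_family_on A {1..l}" "\<And>i. i \<in> {1..l} \<Longrightarrow> finite (A i)"
    and pq: "p \<in> {1..l}" "q \<in> {1..l}" "p \<noteq> q" and r: "r \<ge> 2"
    and F: "simple_graph F" "vertices F = A p \<union> A q" "triangle_free F"
  defines "a \<equiv> \<lambda>i. int (card (A i))"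
  shows "int (clique_count r (replace_on (complete_multipartite l A) (A p \<union> A q) F)) =
    esym a {1..l} r - (a p * a q - int (card (edges F))) * esym a ({1..l} - {p, q}) (r - 2)"
proof -
  let ?U = "A p \<union> A q" and ?X = "{1..l} - {p, q}"
  have disj: "A i \<inter> ?U = {}" if "i \<in> ?X" for i
    using disjoint_family_onD[OF A(1), of i p] disjoint_family_onD[OF A(1), of i q] that pq
    by (simp add: Int_Un_distrib)
  have Q: "{T. [T]\<^bsup>2\<^esup> \<subseteq> edges F} \<inter> [?U]\<^bsup>j\<^esup> = cliques j F" for j
    using F(2) by (auto simp: cliques_def)
  have T: "int (card (transversals s ?X A)) = esym a ?X s" for s
    unfolding a_def using A by (intro card_transversals) (auto simp: disjoint_family_on_def)
  have "clique_count r (replace_on (complete_multipartite l A) ?U F) =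
      (\<Sum>j\<le>r. card (transversals (r - j) ?X A) * card (cliques j F))"
    unfolding clique_count_def cliques_replace_on[OF A(1) pq F(1,2)] Q[symmetric]
    using A pq disj by (intro card_transversals_union) auto
  also have "\<dots> = (\<Sum>j\<in>{0, 1, 2}. card (transversals (r - j) ?X A) * card (cliques j F))"
    using r by (intro sum.mono_neutral_right) (auto simp: card_cliques_triangle_free[OF F(1,3)])
  finally have *: "int (clique_count r (replace_on (complete_multipartite l A) ?U F)) =
      esym a ?X r + esym a ?X (r - 1) * int (card ?U) + esym a ?X (r - 2) * int (card (edges F))"
    by (simp add: card_cliques_triangle_free[OF F(1,3)] F(2) T del: One_nat_def)
  obtain s where s: "r = Suc (Suc s)"
    using r by (metis add_2_eq_Suc le_Suc_ex)
  have "int (card ?U) = a p + a q"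
    using A pq unfolding a_def disjoint_family_on_def by (subst card_Un_disjoint) auto
  moreover have "{1..l} = insert p (insert q ?X)" using pq by auto
  then have "esym a {1..l} r =
      esym a ?X (Suc (Suc s)) + (a p + a q) * esym a ?X (Suc s) + a p * a q * esym a ?X s"
    using esym_insert2[of ?X p q a s] pq s by simp
  ultimately show ?thesis
    unfolding * by (simp add: s algebra_simps)
qed

text \<open>The trace on the two parts is forced to be \<open>{x, y}\<close>, so only
  \<open>r - 2\<close> points from the other parts remain to be chosen.\<close>

lemma card_transversals_containing_edge:
  fixes l :: nat
  assumes A: "disjoint_family_on A {1..l}" "\<And>i. i \<in> {1..l} \<Longrightarrow> finite (A i)"
    and pq: "p \<in> {1..l}" "q \<in> {1..l}" "p \<noteq> q" and r: "r \<ge> 2"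
    and xy: "x \<in> A p" "y \<in> A q"
  shows "int (card {S \<in> transversals r {1..l} A. {x, y} \<subseteq> S}) =
           esym (\<lambda>i. int (card (A i))) ({1..l} - {p, q}) (r - 2)"
proof -
  let ?U = "A p \<union> A q" and ?X = "{1..l} - {p, q}"
  have disjU: "A i \<inter> ?U = {}" if "i \<in> ?X" for i
    using disjoint_family_onD[OF A(1), of i p] disjoint_family_onD[OF A(1), of i q] that pq
    by (simp add: Int_Un_distrib)
  have disj: "A p \<inter> A q = {}" using A(1) pq by (auto simp: disjoint_family_on_def)
  have V: "(\<Union>i\<in>{1..l}. A i) = (\<Union>i\<in>?X. A i) \<union> ?U"
    using pq by auto
  have "(\<forall>i\<in>{1..l}. card (S \<inter> A i) \<le> 1) \<and> {x, y} \<subseteq> S \<longleftrightarrow>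
      (\<forall>i\<in>?X. card (S \<inter> A i) \<le> 1) \<and> S \<inter> ?U \<in> {{x, y}}" if "finite S" for S
  proof (intro iffI conjI)
    assume L: "(\<forall>i\<in>{1..l}. card (S \<inter> A i) \<le> 1) \<and> {x, y} \<subseteq> S"
    then show "\<forall>i\<in>?X. card (S \<inter> A i) \<le> 1" by blast
    have "card (S \<inter> A p) \<le> Suc 0" "card (S \<inter> A q) \<le> Suc 0" using L pq by auto
    then have "S \<inter> A p = {x}" "S \<inter> A q = {y}"
      using L xy \<open>finite S\<close> by (auto simp: card_le_Suc0_iff_eq)
    then show "S \<inter> ?U \<in> {{x, y}}" by auto
  next
    assume R: "(\<forall>i\<in>?X. card (S \<inter> A i) \<le> 1) \<and> S \<inter> ?U \<in> {{x, y}}"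
    then show "{x, y} \<subseteq> S" by auto
    have "S \<inter> A p = {x, y} \<inter> A p" "S \<inter> A q = {x, y} \<inter> A q" using R by blast+
    then have "S \<inter> A p = {x}" "S \<inter> A q = {y}" using xy disj by auto
    then show "\<forall>i\<in>{1..l}. card (S \<inter> A i) \<le> 1" using R by auto
  qed
  note eq = this
  have "{S \<in> transversals r {1..l} A. {x, y} \<subseteq> S} =
      {S \<in> [(\<Union>i\<in>?X. A i) \<union> ?U]\<^bsup>r\<^esup>. (\<forall>i\<in>?X. card (S \<inter> A i) \<le> 1) \<and> S \<inter> ?U \<in> {{x, y}}}"
    (is "?L = ?R")
  proof (rule set_eqI)
    fix S
    show "S \<in> ?L \<longleftrightarrow> S \<in> ?R"
    proof (cases "S \<in> [(\<Union>i\<in>?X. A i) \<union> ?U]\<^bsup>r\<^esup>")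
      case True
      then have "finite S" by (simp add: nsets_def)
      with True show ?thesis
        unfolding transversals_def V mem_Collect_eq using eq[of S] by argo
    next
      case False
      then show ?thesis unfolding transversals_def V mem_Collect_eq by argo
    qed
  qed
  then have "card ?L = card ?R" by (rule arg_cong)
  also have "card ?R = (\<Sum>j\<le>r. card (transversals (r - j) ?X A) * card ({{x, y}} \<inter> [?U]\<^bsup>j\<^esup>))"
  proof (rule card_transversals_union[of ?X A ?U r "{{x, y}}"])
    show "finite (A i)" if "i \<in> ?X" for i using that A(2) by blast
    show "A i \<inter> ?U = {}" if "i \<in> ?X" for i using that by (rule disjU)
    show "finite ?U" using A(2) pq by blast
    show "finite ?X" by simp
  qed
  also have "\<dots> = (\<Sum>j\<in>{2}. card (transversals (r - j) ?X A) * card ({{x, y}} \<inter> [?U]\<^bsup>j\<^esup>))"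
  proof (rule sum.mono_neutral_right)
    have "x \<noteq> y" using xy disj by blast
    then have "card {x, y} = 2" by simp
    then have "{{x, y}} \<inter> [?U]\<^bsup>j\<^esup> = {}" if "j \<noteq> 2" for j
      using that by (auto simp: nsets_def)
    then show "\<forall>j\<in>{..r} - {2}. card (transversals (r - j) ?X A) * card ({{x, y}} \<inter> [?U]\<^bsup>j\<^esup>) = 0"
      by auto
  qed (use r in auto)
  finally have *: "card ?L = card (transversals (r - 2) ?X A) * card ({{x, y}} \<inter> [?U]\<^bsup>2\<^esup>)"
    by simp
  have "{{x, y}} \<inter> [?U]\<^bsup>2\<^esup> = {{x, y}}"
    using xy disj by auto
  moreover have "disjoint_family_on A ?X"
    using A(1) by (rule disjoint_family_on_mono[rotated]) blast
  ultimately show ?thesis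
    unfolding * using card_transversals[of ?X A "r - 2"] A(2) by simp
qed

lemma clique_count_removal:
  assumes A: "disjoint_family_on A {1..k}" "\<And>i. i \<in> {1..k} \<Longrightarrow> finite (A i)"
    and k: "k \<ge> 2" and r: "r \<ge> 2"
  defines "I \<equiv> {i \<in> {1..k-1}. card (A i) = card (A (k-1))}"
  assumes B: "\<forall>i\<in>I. B i \<subseteq> A k" "disjoint_family_on B I"
    and R: "R \<subseteq> {{x, y} |x y. \<exists>i\<in>I. x \<in> B i \<and> y \<in> A i}"
  defines "a \<equiv> \<lambda>i. int (card (A i))" and "K \<equiv> complete_multipartite k A"
  shows "int (clique_count r (vertices K, edges K - R)) =
    esym a {1..k} r - int (card R) * esym a {1..k-2} (r - 2)"
proof -
  let ?T = "transversals r {1..k} A" and ?C = "\<lambda>d. {S \<in> transversals r {1..k} A. d \<subseteq> S}"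
  have finT: "finite ?T"
    using A(2) unfolding transversals_def
    by (intro finite_subset[OF _ finite_imp_finite_nsets[of "\<Union>i\<in>{1..k}. A i" r]]) auto
  have Redge: "\<exists>i x y. i \<in> I \<and> x \<in> B i \<and> x \<in> A k \<and> y \<in> A i \<and> d = {x, y}" if dR: "d \<in> R" for d
  proof -
    obtain x y i where "d = {x, y}" "i \<in> I" "x \<in> B i" "y \<in> A i"
      using subsetD[OF R dR] by blast
    moreover have "x \<in> A k" using B(1) calculation by blast
    ultimately show ?thesis by blast
  qed
  have RV: "d \<in> [\<Union>i\<in>{1..k}. A i]\<^bsup>2\<^esup>" if dR: "d \<in> R" for d
  proof -
    obtain i x y where d: "i \<in> I" "x \<in> A k" "y \<in> A i" "d = {x, y}"
      using Redge[OF dR] by blast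
    then have i: "i \<in> {1..k}" "i \<noteq> k" using k by (auto simp: I_def)
    then have "x \<noteq> y" using d k disjoint_family_onD[OF A(1), of i k] by auto
    then show ?thesis using d i k by auto
  qed
  have "finite R"
  proof (rule finite_subset)
    show "R \<subseteq> [\<Union>i\<in>{1..k}. A i]\<^bsup>2\<^esup>" using RV by blast
    show "finite ([\<Union>i\<in>{1..k}. A i]\<^bsup>2\<^esup>)"
      using A(2) by (intro finite_imp_finite_nsets) blast
  qed
  \<comment> \<open>A clique survives exactly when it contains no deleted edge.\<close>
  have "cliques r (vertices K, edges K - R) = cliques r K - (\<Union>d\<in>R. {S \<in> cliques r K. d \<subseteq> S})"
  proof -
    have "d \<in> [S]\<^bsup>2\<^esup> \<longleftrightarrow> d \<subseteq> S" if "d \<in> R" for d S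
      using RV[OF that] by (auto simp: nsets_def)
    then have "[S]\<^bsup>2\<^esup> \<subseteq> edges K - R \<longleftrightarrow> [S]\<^bsup>2\<^esup> \<subseteq> edges K \<and> (\<forall>d\<in>R. \<not> d \<subseteq> S)" for S
      by blast
    then show ?thesis unfolding cliques_def by auto
  qed
  also have "\<dots> = ?T - (\<Union>d\<in>R. ?C d)"
    unfolding K_def cliques_complete_multipartite[OF A(1)] ..
  finally have cl: "cliques r (vertices K, edges K - R) = ?T - (\<Union>d\<in>R. ?C d)" .
  have sub: "(\<Union>d\<in>R. ?C d) \<subseteq> ?T" by blast
  have "clique_count r (vertices K, edges K - R) = card ?T - card (\<Union>d\<in>R. ?C d)"
    unfolding clique_count_def cl using card_Diff_subset[OF finite_subset[OF sub finT] sub] .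
  moreover have "card (\<Union>d\<in>R. ?C d) \<le> card ?T"
    using card_mono[OF finT sub] .
  moreover have "card (\<Union>d\<in>R. ?C d) = (\<Sum>d\<in>R. card (?C d))"
  proof (rule card_UN_disjoint[OF \<open>finite R\<close>])
    have "d = d'" if dd': "d \<in> R" "d' \<in> R" and S: "S \<in> ?T" "d \<subseteq> S" "d' \<subseteq> S" for d d' S
    proof -
      obtain i x y where d: "i \<in> I" "x \<in> B i" "x \<in> A k" "y \<in> A i" "d = {x, y}"
        using Redge[OF dd'(1)] by blast
      obtain i' x' y' where d': "i' \<in> I" "x' \<in> B i'" "x' \<in> A k" "y' \<in> A i'" "d' = {x', y'}"
        using Redge[OF dd'(2)] by blast
      have one: "u = v" if "j \<in> {1..k}" "u \<in> S \<inter> A j" "v \<in> S \<inter> A j" for j u v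
      proof -
        have "card (S \<inter> A j) \<le> Suc 0" "finite (S \<inter> A j)"
          using S(1) that(1) by (auto simp: transversals_def nsets_def)
        then show ?thesis using that by (auto simp: card_le_Suc0_iff_eq)
      qed
      \<comment> \<open>The only point of \<open>S\<close> in \<open>A k\<close> determines the
        index, because the sets \<open>B i\<close> are disjoint. The only point of \<open>S\<close>
        in that part is then the other end of the edge.\<close>
      have "x = x'" using one[of k x x'] d d' S(2,3) k by simp
      then have "i = i'" using d d' disjoint_family_onD[OF B(2), of i i'] by blast
      moreover have "i \<in> {1..k}" using d(1) by (auto simp: I_def)
      ultimately have "y = y'" using one[of i y y'] d d' S(2,3) by simp
      then show ?thesis using d d' \<open>x = x'\<close> by simp
    qed
    then show "\<forall>d\<in>R. \<forall>d'\<in>R. d \<noteq> d' \<longrightarrow> ?C d \<inter> ?C d' = {}" by blast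
  qed (use finT in auto)
  moreover have "int (card (?C d)) = esym a {1..k-2} (r - 2)" if dR: "d \<in> R" for d
  proof -
    obtain i x y where d: "i \<in> I" "x \<in> A k" "y \<in> A i" "d = {x, y}"
      using Redge[OF dR] by blast
    then have i: "i \<in> {1..k-1}" "card (A i) = card (A (k-1))" by (auto simp: I_def)
    have "int (card (?C d)) = esym a ({1..k} - {k, i}) (r - 2)"
      unfolding d(4) a_def using A i k r d by (intro card_transversals_containing_edge) auto
    \<comment> \<open>Part \<open>i\<close> has the size of part \<open>k - 1\<close>, so leaving
      out either gives the same polynomial.\<close>
    also have "{1..k} - {k, i} = {1..k-1} - {i}" using k by auto
    also have "esym a ({1..k-1} - {i}) (r - 2) = esym a ({1..k-1} - {k-1}) (r - 2)"
      using i k by (intro esym_remove_eq) (auto simp: a_def)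
    also have "{1..k-1} - {k-1} = {1..k-2}" using k by auto
    finally show ?thesis .
  qed
  then have "int (\<Sum>d\<in>R. card (?C d)) = int (card R) * esym a {1..k-2} (r - 2)"
    by simp
  moreover have "int (card ?T) = esym a {1..k} r"
    unfolding a_def using A by (intro card_transversals) auto
  ultimately show ?thesis by (simp add: of_nat_diff)
qed

text \<open>Both vectors share the entries \<open>a 2\<close> to \<open>a (k - 1)\<close>. The other
  two keep their sum, while their product grows by \<open>a 1 - a k - 1\<close>; the subtracted term
  removes exactly this gain.\<close>

lemma esym_alt_sizes:
  fixes a :: "nat \<Rightarrow> nat"
  assumes k: "k \<ge> 2" and r: "r \<ge> 2" and a1: "a 1 \<ge> 1"
  defines "b \<equiv> alt_sizes k a"
  shows "esym (\<lambda>i. int (b i)) {1..k} r - (int (a 1) - int (a k) - 1) * esym (\<lambda>i. int (b i)) {1..k-2} (r - 2)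
    = esym (\<lambda>i. int (a i)) {1..k} r"
proof -
  let ?a = "\<lambda>i. int (a i)" and ?b = "\<lambda>i. int (b i)"
  obtain s where s: "r = Suc (Suc s)"
    using r by (metis add_2_eq_Suc le_Suc_ex)
  have ba: "esym ?b {1..k-2} j = esym ?a {2..k-1} j" for j
  proof -
    have "esym ?b {1..k-2} j = esym (\<lambda>i. ?a (Suc i)) {1..k-2} j"
      using k by (intro esym_cong) (auto simp: b_def alt_sizes_def)
    also have "\<dots> = esym ?a (Suc ` {1..k-2}) j"
      by (intro esym_reindex) auto
    also have "Suc ` {1..k-2} = {2..k-1}"
    proof -
      have "Suc (k - 2) = k - 1" "Suc 1 = 2" using k by auto
      then show ?thesis by (simp only: image_Suc_atLeastAtMost)
    qed
    finally show ?thesis .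
  qed
  have "{1..k} = insert (k-1) (insert k {1..k-2})" using k by auto
  then have "esym ?b {1..k} r = esym ?b {1..k-2} (Suc (Suc s))
      + (?b (k-1) + ?b k) * esym ?b {1..k-2} (Suc s) + ?b (k-1) * ?b k * esym ?b {1..k-2} s"
    unfolding s using k by (simp only: ) (intro esym_insert2, auto)
  moreover have "?b k = ?a k + 1" "?b (k-1) = ?a 1 - 1"
    using k a1 by (auto simp: b_def alt_sizes_def)
  moreover have "{1..k} = insert 1 (insert k {2..k-1})" using k by auto
  then have "esym ?a {1..k} r = esym ?a {2..k-1} (Suc (Suc s))
      + (?a 1 + ?a k) * esym ?a {2..k-1} (Suc s) + ?a 1 * ?a k * esym ?a {2..k-1} s"
    unfolding s using k by (simp only: ) (intro esym_insert2, auto)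
  ultimately show ?thesis
    by (simp add: ba s algebra_simps del: One_nat_def)
qed

section \<open>The clique count throughout the second family\<close>

theorem clique_count_H2star:
  assumes k: "k_of n e \<ge> 2" and r: "r \<ge> 2" and G: "G \<in> H2star n e"
  shows "int (clique_count r G) = hstar r n e"
proof -
  define k where "k = k_of n e"
  define a where "a = astar n e"
  define ia where "ia = (\<lambda>i. int (a i))"
  have k2: "k \<ge> 2" using k by (simp add: k_def)
  have h: "hstar r n e = esym ia {1..k} r - mstar n e * esym ia {1..k-2} (r - 2)"
    unfolding hstar_def esym_def k_def a_def ia_def ..
  have sizes: "esym (\<lambda>i. int (card (A i))) X s = esym (\<lambda>i. int (c i)) X s"
    if "parts_of_sizes k c A" "X \<subseteq> {1..k}" for A :: "nat \<Rightarrow> 'a set" and X s c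
    using that by (intro esym_cong) (auto simp: parts_of_sizes_def)
  from G consider (H1) "G \<in> H1star n e" | (rem) "G \<in> H2_removal n e"
    by (auto simp: H2star_def)
  then show ?thesis
  proof cases
    case H1
    then obtain A where A: "parts_of_sizes k a A" and
      "(mstar n e = 0 \<and>
         (\<exists>i\<in>{1..k-1}. \<exists>F. simple_graph F \<and> vertices F = A i \<union> A k \<and> triangle_free F \<and>
            card (edges F) = a i * a k \<and>
            G = replace_on (complete_multipartite k A) (A i \<union> A k) F)) \<or>
        (mstar n e > 0 \<and>
         (\<exists>F. simple_graph F \<and> vertices F = A (k-1) \<union> A k \<and> triangle_free F \<and>
            int (card (edges F)) = int (a (k-1) * a k) - mstar n e \<and>
            G = replace_on (complete_multipartite k A) (A (k-1) \<union> A k) F))"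
      unfolding H1star_def k_def[symmetric] a_def[symmetric] Let_def mem_Collect_eq by blast
    \<comment> \<open>The two cases merge: for \<open>mstar n e = 0\<close> the prescribed number of
      edges is also \<open>a i * a k - mstar n e\<close>.\<close>
    then obtain i F where F: "simple_graph F" "vertices F = A i \<union> A k" "triangle_free F"
      "int (card (edges F)) = int (a i * a k) - mstar n e"
      "G = replace_on (complete_multipartite k A) (A i \<union> A k) F"
      and i: "i \<in> {1..k-1}" "mstar n e = 0 \<or> i = k - 1"
      using k2 by (elim disjE conjE bexE exE) (auto intro!: that)
    have A': "disjoint_family_on A {1..k}" "\<And>j. j \<in> {1..k} \<Longrightarrow> finite (A j)"
      "\<And>j. j \<in> {1..k} \<Longrightarrow> card (A j) = a j"
      using A by (auto simp: parts_of_sizes_def)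
    have "int (clique_count r G) =
        esym ia {1..k} r - mstar n e * esym ia ({1..k} - {i, k}) (r - 2)"
      unfolding F(5)
      using i k2 F r A' A by (subst clique_count_replace_on) (auto simp: sizes ia_def)
    \<comment> \<open>The index \<open>i\<close> can differ from \<open>k - 1\<close> only when
      \<open>mstar\<close> is 0, and then both sides vanish.\<close>
    also have "mstar n e * esym ia ({1..k} - {i, k}) (r - 2) = mstar n e * esym ia {1..k-2} (r - 2)"
      using i(2)
    proof
      assume "i = k - 1"
      moreover have "{1..k} - {k-1, k} = {1..k-2}" using k2 by auto
      ultimately show ?thesis by simp
    qed simp
    finally show ?thesis unfolding h .
  next
    case rem
    then obtain A m B R where
      mA: "(parts_of_sizes k a A \<and> m = mstar n e) \<or>
        (mstar n e = 0 \<and> a 1 \<ge> a k + 2 \<and>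
         parts_of_sizes k (alt_sizes k a) A \<and> m = int (a 1) - int (a k) - 1)"
      and B: "\<forall>i\<in>{i\<in>{1..k-1}. card (A i) = card (A (k-1))}. B i \<subseteq> A k"
        "disjoint_family_on B {i\<in>{1..k-1}. card (A i) = card (A (k-1))}"
      and R: "R \<subseteq> {{x, y} |x y. \<exists>i\<in>{i\<in>{1..k-1}. card (A i) = card (A (k-1))}. x \<in> B i \<and> y \<in> A i}"
        "int (card R) = m"
      and G: "G = (vertices (complete_multipartite k A), edges (complete_multipartite k A) - R)"
      unfolding H2_removal_def k_def[symmetric] a_def[symmetric] Let_def mem_Collect_eq
      by (elim exE conjE) (rule that, assumption+)
    have A': "disjoint_family_on A {1..k}" "\<And>j. j \<in> {1..k} \<Longrightarrow> finite (A j)"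
      using mA by (auto simp: parts_of_sizes_def)
    have count: "int (clique_count r G) =
        esym (\<lambda>i. int (card (A i))) {1..k} r - m * esym (\<lambda>i. int (card (A i))) {1..k-2} (r - 2)"
      unfolding G R(2)[symmetric] using k2 r by (intro clique_count_removal[OF A' _ _ B R(1)]) auto
    from mA show ?thesis
    proof (elim disjE conjE)
      assume "parts_of_sizes k a A" "m = mstar n e"
      then show ?thesis unfolding count h by (simp add: sizes ia_def)
    next
      assume *: "mstar n e = 0" "a 1 \<ge> a k + 2" "parts_of_sizes k (alt_sizes k a) A"
        "m = int (a 1) - int (a k) - 1"
      \<comment> \<open>As \<open>mstar\<close> is 0, \<open>hstar\<close> is just its first sum,
        which is the value supplied by \<open>esym_alt_sizes\<close>.\<close>
      show ?thesis
        unfolding count h using * esym_alt_sizes[of k r a] k2 r by (simp add: sizes ia_def)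
    qed
  qed
qed

section \<open>Turan numbers\<close>

lemma turan_number_sum_squares:
  fixes s n :: nat
  assumes s: "s \<ge> 1"
  defines "c \<equiv> \<lambda>i. int (card {v. v < n \<and> v mod s + 1 = i})"
  shows "2 * int (turan_number s n) + (\<Sum>i=1..s. (c i)\<^sup>2) = (int n)\<^sup>2"
    and "(\<Sum>i=1..s. c i) = int n"
proof -
  let ?A = "\<lambda>i. {v. v < n \<and> v mod s + 1 = i}"
  have disj: "disjoint_family_on ?A {1..s}"
    by (auto simp: disjoint_family_on_def)
  have "(\<Union>i\<in>{1..s}. ?A i) = {..<n}"
  proof -
    have "v mod s + 1 \<in> {1..s}" for v
      using s by (simp add: Suc_leI)
    then show ?thesis by auto
  qed
  then have "card {..<n} = (\<Sum>i=1..s. card (?A i))"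
    using disj by (subst card_UN_disjoint[symmetric]) (auto simp: disjoint_family_on_def)
  then show sum: "(\<Sum>i=1..s. c i) = int n"
    by (simp add: c_def flip: of_nat_sum)
  have "int (turan_number s n) = esym c {1..s} 2"
    unfolding turan_number_def turan_graph_def c_def
    by (intro card_edges_complete_multipartite disj) simp
  then show "2 * int (turan_number s n) + (\<Sum>i=1..s. (c i)\<^sup>2) = (int n)\<^sup>2"
    using esym_2[of "{1..s}" c] sum by simp
qed

text \<open>This is the bound \<open>t_s(n) \<le> (1 - 1/s) n^2 / 2\<close> with denominators
  cleared. It is Cauchy-Schwarz for the class sizes, obtained from the nonnegativity of their
  squared deviations from the mean.\<close>

lemma turan_number_le:
  assumes "s \<ge> 1"
  shows "2 * int s * int (turan_number s n) \<le> (int s - 1) * (int n)\<^sup>2"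
proof -
  define c where "c = (\<lambda>i. int (card {v. v < n \<and> v mod s + 1 = i}))"
  have t: "2 * int (turan_number s n) + (\<Sum>i=1..s. (c i)\<^sup>2) = (int n)\<^sup>2" "(\<Sum>i=1..s. c i) = int n"
    unfolding c_def by (rule turan_number_sum_squares[OF assms])+
  have "0 \<le> (\<Sum>i=1..s. (int s * c i - int n)\<^sup>2)"
    by (intro sum_nonneg) simp
  also have "\<dots> = (int s)\<^sup>2 * (\<Sum>i=1..s. (c i)\<^sup>2) - 2 * int s * int n * (\<Sum>i=1..s. c i) + int s * (int n)\<^sup>2"
    by (simp add: power2_diff sum.distrib sum_subtractf sum_distrib_left algebra_simps power2_eq_square)
  also have "\<dots> = int s * (int s * (\<Sum>i=1..s. (c i)\<^sup>2) - (int n)\<^sup>2)"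
    unfolding t(2) by (simp add: algebra_simps power2_eq_square)
  finally have "(int n)\<^sup>2 \<le> int s * (\<Sum>i=1..s. (c i)\<^sup>2)"
    using assms by (simp add: zero_le_mult_iff)
  moreover have "int s * (2 * int (turan_number s n)) + int s * (\<Sum>i=1..s. (c i)\<^sup>2) = int s * (int n)\<^sup>2"
    using arg_cong[OF t(1), of "\<lambda>x. int s * x"] by (simp only: distrib_left)
  ultimately show ?thesis by (simp add: algebra_simps)
qed

text \<open>When \<open>s\<close> divides the number of vertices, every residue class has exactly
  \<open>q\<close> elements, so the sum of squares is known exactly.\<close>

lemma turan_number_mult:
  assumes s: "s \<ge> 1"
  shows "2 * int (turan_number s (s * q)) + int s * (int q)\<^sup>2 = (int (s * q))\<^sup>2"
proof -
  have "card {v. v < s * q \<and> v mod s + 1 = i} = q" if i: "i \<in> {1..s}" for i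
  proof -
    obtain x where x: "i = Suc x" "x < s" using i by (cases i) auto
    have "bij_betw (\<lambda>j. j * s + x) {..<q} {v. v < s * q \<and> v mod s + 1 = i}"
    proof (rule bij_betw_byWitness[where f' = "\<lambda>v. v div s"])
      show "\<forall>j\<in>{..<q}. (j * s + x) div s = j"
        using x by simp
      show "\<forall>v\<in>{v. v < s * q \<and> v mod s + 1 = i}. v div s * s + x = v"
        using x by auto
      have "j * s + x < s * q" if "j < q" for j
      proof -
        have "j * s + x < Suc j * s" using x by simp
        also have "\<dots> \<le> q * s" using that by (intro mult_le_mono1) simp
        finally show ?thesis by (simp add: mult.commute)
      qed
      then show "(\<lambda>j. j * s + x) ` {..<q} \<subseteq> {v. v < s * q \<and> v mod s + 1 = i}"
        using x by auto
      show "(\<lambda>v. v div s) ` {v. v < s * q \<and> v mod s + 1 = i} \<subseteq> {..<q}"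
        by (auto simp: less_mult_imp_div_less mult.commute)
    qed
    then show ?thesis by (simp add: bij_betw_same_card[symmetric])
  qed
  then show ?thesis
    using turan_number_sum_squares(1)[OF s, of "s * q"] by simp
qed

lemma two_choose_two: "2 * int (n choose 2) = int n * (int n - 1)"
proof (cases n)
  case (Suc m)
  have "2 * (n choose 2) = n * m"
    using Suc by (simp add: choose_two)
  then have "int (2 * (n choose 2)) = int (n * m)" by (simp only:)
  then show ?thesis using Suc by (simp add: distrib_right)
qed simp

text \<open>All parts are singletons. Hence some \<open>s\<close> satisfies the condition in
  \<open>k_of\<close> whenever \<open>e \<le> n choose 2\<close>.\<close>

lemma turan_number_self:
  assumes "n \<ge> 1"
  shows "turan_number n n = n choose 2"
proof -
  have "2 * int (turan_number n n) = int n * (int n - 1)"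
    using turan_number_mult[OF assms, of 1] by (simp add: algebra_simps power2_eq_square)
  then show ?thesis using two_choose_two[of n] by linarith
qed

section \<open>Graphs outside the first family\<close>

locale equal_parts_but_one =
  fixes k c :: nat
  assumes k: "k \<ge> 4" and c: "c \<ge> 2"
begin

text \<open>The gap \<open>p - c = k\<close> makes \<open>n\<close> a multiple of \<open>k\<close>,
  so that \<open>T_k(n)\<close> has equal parts, and it is at least 4, as \<open>least_part\<close>
  requires.\<close>

definition p :: nat where "p = c + k"

definition n :: nat where "n = (k - 1) * p + c"

definition a :: "nat \<Rightarrow> nat" where
  "a i = (if i \<in> {1..k-1} then p else if i = k then c else 0)"

text \<open>Two edges fewer than in the complete \<open>k\<close>-partite graph with part sizes
  \<open>a\<close>, so that \<open>mstar\<close> becomes 2 and two edges are to be deleted.\<close>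

definition e :: nat where "e = nat (esym (\<lambda>i. int (a i)) {1..k} 2 - 2)"

lemma split_k: "{1..k} = insert k {1..k-1}"
  using k by auto

lemma int_k: "int (k - 1) = int k - 1"
  using k by simp

lemma int_p: "int p = int c + int k"
  by (simp add: p_def)

lemma int_n: "int n = (int k - 1) * int p + int c"
  using k by (simp add: n_def int_k)

lemma n_eq: "n = k * (c + k - 1)"
proof -
  have "int (k * (c + k - 1)) = int k * (int c + int k - 1)"
    using k by (simp add: of_nat_diff)
  then have "int n = int (k * (c + k - 1))"
    by (simp only: int_n int_p) (simp add: algebra_simps)
  then show ?thesis by (simp only: of_nat_eq_iff)
qed

lemma a_simps: "i \<in> {1..k-1} \<Longrightarrow> a i = p" "a k = c" "i \<notin> {1..k} \<Longrightarrow> a i = 0"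
  using k by (auto simp: a_def)

lemma sum_a: "(\<Sum>i=1..k. f (a i)) = (int k - 1) * f p + f c" for f :: "nat \<Rightarrow> int"
proof -
  have "(\<Sum>i=1..k. f (a i)) = f (a k) + (\<Sum>i=1..k-1. f (a i))"
    unfolding split_k using k by (intro sum.insert) auto
  also have "(\<Sum>i=1..k-1. f (a i)) = (\<Sum>i=1..k-1. f p)"
    by (intro sum.cong) (simp_all add: a_simps(1) del: atLeastAtMost_iff)
  finally show ?thesis using k by (simp add: a_simps int_k)
qed

lemma esym_a: "2 * esym (\<lambda>i. int (a i)) {1..k} 2 + (int k - 1) * (int p)\<^sup>2 + (int c)\<^sup>2 = (int n)\<^sup>2"
  using esym_2[of "{1..k}" "\<lambda>i. int (a i)"] sum_a[of int] sum_a[of "\<lambda>x. (int x)\<^sup>2"]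
  by (simp add: int_n)

lemma size_bounds: "(int c)\<^sup>2 + 4 * int c \<le> int p * int c" "int c * 4 \<ge> 8" "int p \<ge> int c + 4"
  using k c by (auto simp: int_p algebra_simps power2_eq_square)

lemma n_square: "(int n)\<^sup>2 = (int k - 1) * ((int k - 1) * (int p)\<^sup>2) + 2 * ((int k - 1) * (int p * int c)) + (int c)\<^sup>2"
  unfolding int_n by (simp add: power2_eq_square algebra_simps)

lemma two_e: "2 * int e + (int k - 1) * (int p)\<^sup>2 + (int c)\<^sup>2 + 4 = (int n)\<^sup>2"
  and esym_a_eq: "esym (\<lambda>i. int (a i)) {1..k} 2 = int e + 2"
proof -
  have "(int k - 1) * (int p)\<^sup>2 \<le> (int k - 1) * ((int k - 1) * (int p)\<^sup>2)"
    using k by (intro mult_left_mono) (auto simp: mult_le_cancel_right1)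
  moreover have "1 * (int p * int c) \<le> (int k - 1) * (int p * int c)"
    using k by (intro mult_right_mono) auto
  \<comment> \<open>This bound ensures that \<open>nat\<close> does not truncate in the definition
    of \<open>e\<close>.\<close>
  ultimately have "esym (\<lambda>i. int (a i)) {1..k} 2 \<ge> 2"
    using esym_a n_square size_bounds zero_le_power2[of "int c"] by linarith
  then show "esym (\<lambda>i. int (a i)) {1..k} 2 = int e + 2"
    by (simp add: e_def)
  then show "2 * int e + (int k - 1) * (int p)\<^sup>2 + (int c)\<^sup>2 + 4 = (int n)\<^sup>2"
    using esym_a by simp
qed

text \<open>Otherwise \<open>turan_number_le\<close> gives
  \<open>n^2 \<le> s ((k-1) p^2 + c^2 + 4)\<close>. Raising \<open>s\<close> to \<open>k - 1\<close>
  and cancelling leaves \<open>2 (k-1) p c + c^2 \<le> (k-1) (c^2 + 4)\<close>, contradicting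
  \<open>p c \<ge> c^2 + 4\<close>.\<close>

lemma turan_number_less:
  assumes "1 \<le> s" "s < k"
  shows "turan_number s n < e"
proof (rule ccontr)
  assume "\<not> turan_number s n < e"
  then have "int s * (2 * int e) \<le> int s * (2 * int (turan_number s n))"
    by (intro mult_left_mono) auto
  also have "\<dots> \<le> (int s - 1) * (int n)\<^sup>2"
    using turan_number_le[OF assms(1), of n] by (simp add: mult.assoc mult.left_commute)
  finally have "int s * (2 * int e) \<le> (int s - 1) * (int n)\<^sup>2" .
  moreover have "2 * int e = (int n)\<^sup>2 - ((int k - 1) * (int p)\<^sup>2 + (int c)\<^sup>2 + 4)"
    using two_e by simp
  ultimately have "(int n)\<^sup>2 \<le> int s * ((int k - 1) * (int p)\<^sup>2 + (int c)\<^sup>2 + 4)"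
    by (simp add: algebra_simps)
  also have "\<dots> \<le> (int k - 1) * ((int k - 1) * (int p)\<^sup>2 + (int c)\<^sup>2 + 4)"
    using assms k by (intro mult_right_mono) auto
  finally have "2 * ((int k - 1) * (int p * int c)) + (int c)\<^sup>2 \<le> (int k - 1) * ((int c)\<^sup>2 + 4)"
    using n_square by (simp add: distrib_left)
  moreover have "(int k - 1) * ((int c)\<^sup>2 + 4) \<le> (int k - 1) * (int p * int c)"
    using size_bounds k by (intro mult_left_mono) auto
  moreover have "(int k - 1) * (int p * int c) > 0" "(int c)\<^sup>2 > 0"
    using k c size_bounds by auto
  ultimately show False by linarith
qed

text \<open>Since \<open>n = k (c + k - 1)\<close>, the parts of \<open>T\<^sub>k(n)\<close> all have size \<open>q = c + k - 1\<close>.\<close>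

lemma e_le_turan_number: "e \<le> turan_number k n"
proof -
  define q where "q = c + k - 1"
  have q: "int p = int q + 1" "int c = int q - (int k - 1)"
    using k by (auto simp: q_def p_def)
  have "2 * int (turan_number k n) + int k * (int q)\<^sup>2 = (int n)\<^sup>2"
    using turan_number_mult[of k q] k by (simp add: n_eq q_def)
  \<comment> \<open>The deviations from \<open>q\<close> are 1 for \<open>k - 1\<close> parts and
    \<open>-(k - 1)\<close> for the last, so the linear terms cancel.\<close>
  moreover have "(int k - 1) * (int p)\<^sup>2 + (int c)\<^sup>2 = int k * (int q)\<^sup>2 + (int k - 1) + (int k - 1)\<^sup>2"
    unfolding q by (simp add: power2_eq_square algebra_simps)
  moreover have "(int k - 1)\<^sup>2 \<ge> 0" by simp
  ultimately show ?thesis using two_e k by linarith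
qed

lemma k_of_eq: "k_of n e = k"
  unfolding k_of_def
proof (rule Least_equality)
  show "1 \<le> k \<and> e \<le> turan_number k n"
    using k e_le_turan_number by simp
  show "k \<le> s" if "1 \<le> s \<and> e \<le> turan_number s n" for s
    using turan_number_less[of s] that by (meson leD not_le_imp_less)
qed

lemma n_ge: "c \<le> n" "n \<ge> 1"
  using k c by (auto simp: n_def)

lemma least_part:
  "(LEAST b. 1 \<le> b \<and> b \<le> n \<and> e \<le> b * (n - b) + turan_number (k - 1) (n - b)) = c"
proof (rule Least_equality)
  \<comment> \<open>The remaining vertices split evenly into \<open>k - 1\<close> parts of size
    \<open>p\<close>, so at \<open>c\<close> the right-hand side exceeds \<open>e\<close> by exactly
    2.\<close>
  have nc: "n - c = (k - 1) * p" by (simp add: n_def)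
  have "2 * int (turan_number (k - 1) (n - c)) + (int k - 1) * (int p)\<^sup>2 = ((int k - 1) * int p)\<^sup>2"
    using turan_number_mult[of "k - 1" p] k unfolding nc by (simp add: int_k)
  then have "2 * int e \<le> 2 * (int c * ((int k - 1) * int p) + int (turan_number (k - 1) (n - c)))"
    using two_e n_square by (simp add: power2_eq_square algebra_simps)
  moreover have "int (n - c) = (int k - 1) * int p"
    unfolding nc by (simp only: of_nat_mult int_k)
  ultimately have "int e \<le> int (c * (n - c) + turan_number (k - 1) (n - c))"
    by (simp only: of_nat_add of_nat_mult mult_le_cancel_left_pos zero_less_numeral)
  then show "1 \<le> c \<and> c \<le> n \<and> e \<le> c * (n - c) + turan_number (k - 1) (n - c)"
    using c n_ge by (simp only: of_nat_le_iff) simp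
next
  fix b assume b: "1 \<le> b \<and> b \<le> n \<and> e \<le> b * (n - b) + turan_number (k - 1) (n - b)"
  show "c \<le> b"
  proof (rule ccontr)
    assume "\<not> c \<le> b"
    \<comment> \<open>With \<open>t\<^sub>k\<^sub>-\<^sub>1\<close> replaced by its quadratic upper bound, a last part of size \<open>c - d\<close> loses
      at least \<open>d (p - c) > 2\<close> edges.\<close>
    define K where "K = int k - 1"
    define d where "d = int c - int b"
    have d: "d \<ge> 1" using \<open>\<not> c \<le> b\<close> by (simp add: d_def)
    have K: "K \<ge> 3" "int (k - 1) = K" using k by (auto simp: K_def)
    have N: "int (n - b) = K * int p + d"
      using b by (simp add: of_nat_diff int_n K_def d_def)
    have "int e \<le> int (b * (n - b) + turan_number (k - 1) (n - b))"
      using b by (simp only: of_nat_le_iff)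
    then have "int e \<le> (int c - d) * (K * int p + d) + int (turan_number (k - 1) (n - b))"
      by (simp add: N d_def)
    then have "K * (2 * int e) \<le> K * (2 * ((int c - d) * (K * int p + d) + int (turan_number (k - 1) (n - b))))"
      using K by (intro mult_left_mono) auto
    also have "\<dots> = 2 * K * ((int c - d) * (K * int p + d)) + 2 * K * int (turan_number (k - 1) (n - b))"
      by (simp add: algebra_simps)
    also have "\<dots> \<le> 2 * K * ((int c - d) * (K * int p + d)) + (K - 1) * (K * int p + d)\<^sup>2"
      using turan_number_le[of "k - 1" "n - b"] k unfolding N K by simp
    finally have "K * (2 * int e) \<le> \<dots>" .
    moreover have "2 * int e = (int n)\<^sup>2 - (K * (int p)\<^sup>2 + (int c)\<^sup>2 + 4)"
      using two_e by (simp add: K_def)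
    moreover have "(int n)\<^sup>2 = (K * int p + int c)\<^sup>2" by (simp add: int_n K_def)
    \<comment> \<open>After expansion, the terms in \<open>p^2\<close>, \<open>p c\<close> and
      \<open>c^2\<close> all cancel.\<close>
    ultimately have "2 * (K * (d * (int p - int c))) + (K + 1) * d\<^sup>2 \<le> 4 * K"
      by (simp add: power2_eq_square algebra_simps)
    moreover have "K * (1 * 4) \<le> K * (d * (int p - int c))"
      using K d size_bounds by (intro mult_left_mono mult_mono) auto
    moreover have "(K + 1) * d\<^sup>2 \<ge> 0" using K by simp
    ultimately show False using K by linarith
  qed
qed

lemma astar_eq: "astar n e = a"
  unfolding astar_def
proof (rule the_equality)
  have "(\<Sum>i=1..k-1. a i) = (\<Sum>i=1..k-1. p)"
    by (intro sum.cong) (simp_all add: a_simps(1) del: atLeastAtMost_iff)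
  then have "(\<Sum>i=1..k-1. a i) = n - c"
    by (simp add: n_def)
  then show "is_astar n e a"
    unfolding is_astar_def k_of_eq Let_def least_part a_simps(2)
    using k c by (auto simp: a_def p_def)
next
  fix b assume b: "is_astar n e b"
  have b: "\<And>i. i \<notin> {1..k} \<Longrightarrow> b i = 0" "b k = c" "(\<Sum>i=1..k-1. b i) = (k - 1) * p"
    "\<And>i j. i \<in> {1..k-1} \<Longrightarrow> j \<in> {1..k-1} \<Longrightarrow> i \<le> j \<Longrightarrow> b j \<le> b i" "b 1 \<le> b (k - 1) + 1"
    using b unfolding is_astar_def k_of_eq Let_def least_part by (auto simp: n_def)
  have ends: "1 \<in> {1..k-1}" "k - 1 \<in> {1..k-1}" using k by auto
  \<comment> \<open>An entry below \<open>p\<close> forces the last of these \<open>k - 1\<close>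
    entries below \<open>p\<close>. A spread of at most one then keeps all of them at most
    \<open>p\<close>, and their sum is too small.\<close>
  have ge: "b i \<ge> p" if i: "i \<in> {1..k-1}" for i
  proof (rule ccontr)
    assume "\<not> b i \<ge> p"
    then have "b (k - 1) < p" using b(4)[OF i ends(2)] i by auto
    then have "b j \<le> p" if "j \<in> {1..k-1}" for j
      using b(4)[OF ends(1) that] b(5) that by auto
    then have "(\<Sum>i=1..k-1. b i) < (\<Sum>i=1..k-1. p)"
      using ends(2) \<open>b (k - 1) < p\<close> by (intro sum_strict_mono_ex1) auto
    then show False using b(3) by simp
  qed
  \<comment> \<open>With every entry at least \<open>p\<close>, the prescribed sum
    \<open>(k - 1) * p\<close> leaves no room for a larger one.\<close>
  have le: "b i = p" if i: "i \<in> {1..k-1}" for i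
  proof (rule ccontr)
    assume "b i \<noteq> p"
    then have "p < b i" using ge[OF i] by simp
    then have "(\<Sum>i=1..k-1. p) < (\<Sum>i=1..k-1. b i)"
      using i ge by (intro sum_strict_mono_ex1) auto
    then show False using b(3) by simp
  qed
  show "b = a"
  proof
    fix i show "b i = a i"
      using b(1)[of i] b(2) le[of i] k by (auto simp: a_def)
  qed
qed

lemma mstar_eq: "mstar n e = 2"
  using esym_a_eq unfolding mstar_def k_of_eq astar_eq esym_def by simp

section \<open>The example graph, its parts and its deleted edges\<close>

definition A :: "nat \<Rightarrow> nat set" where "A i = {i * p ..< i * p + a i}"

lemma a_le: "a i \<le> p"
  by (simp add: a_def p_def)

text \<open>Since \<open>a i \<le> p\<close>, the interval \<open>A i\<close> consists of numbers
  with quotient \<open>i\<close> modulo division by \<open>p\<close>, and disjointness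
  follows.\<close>

lemma parts_A: "parts_of_sizes k a A"
proof -
  have "x div p = i" if "x \<in> A i" for x i
    using that a_le[of i] by (auto simp: A_def algebra_simps intro!: div_nat_eqI)
  then have "disjoint_family_on A {1..k}"
    unfolding disjoint_family_on_def by blast
  then show ?thesis by (auto simp: parts_of_sizes_def A_def)
qed

text \<open>The ends \<open>k * p\<close> and \<open>k * p + 1\<close> are two distinct vertices of
  the last part, available because \<open>c \<ge> 2\<close>; the other ends are the first vertices
  of \<open>A 1\<close> and \<open>A 2\<close>.\<close>

definition R :: "nat set set" where "R = {{k * p, 1 * p}, {k * p + 1, 2 * p}}"

definition G :: "nat ugraph" where
  "G = (vertices (complete_multipartite k A), edges (complete_multipartite k A) - R)"

lemma mem_A: "k * p \<in> A k" "k * p + 1 \<in> A k" "1 * p \<in> A 1" "2 * p \<in> A 2"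
  using k c by (auto simp: A_def a_def p_def)

lemma G_in_H2_removal: "G \<in> H2_removal n e"
proof -
  \<comment> \<open>Singletons at indices 1 and 2 suffice; both indices qualify because parts 1, 2
    and \<open>k - 1\<close> all have size \<open>p\<close>.\<close>
  define B where "B = (\<lambda>i :: nat. if i = 1 then {k * p} else if i = 2 then {k * p + 1} else {})"
  define I where "I = {i\<in>{1..k-1}. card (A i) = card (A (k - 1))}"
  have I: "1 \<in> I" "2 \<in> I" using k by (auto simp: I_def A_def a_def)
  have "p > 0" using c by (simp add: p_def)
  then have "k * p \<noteq> 2 * p" "k * p \<noteq> p" using k by auto
  then have "card R = 2"
    by (auto simp: R_def doubleton_eq_iff card_insert_if)
  moreover have "\<forall>i\<in>I. B i \<subseteq> A k" using mem_A by (auto simp: B_def)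
  moreover have "disjoint_family_on B I" by (auto simp: B_def disjoint_family_on_def)
  moreover have "R \<subseteq> {{x, y} |x y. \<exists>i\<in>I. x \<in> B i \<and> y \<in> A i}"
  proof -
    have "k * p \<in> B 1" "k * p + 1 \<in> B 2" by (auto simp: B_def)
    then show ?thesis using I mem_A unfolding R_def by blast
  qed
  ultimately show ?thesis
    unfolding H2_removal_def k_of_eq astar_eq mstar_eq Let_def mem_Collect_eq I_def
    using parts_A G_def by (intro exI[of _ A] exI[of _ 2] exI[of _ B] exI[of _ R]) simp
qed

lemma G_not_in_H1star: "G \<notin> H1star n e"
proof
  assume "G \<in> H1star n e"
  \<comment> \<open>As \<open>mstar\<close> is 2, only the last two parts can have been
    replaced.\<close>
  then obtain A' F where A': "parts_of_sizes k a A'"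
    and G': "G = replace_on (complete_multipartite k A') (A' (k - 1) \<union> A' k) F"
    unfolding H1star_def k_of_eq astar_eq mstar_eq Let_def by auto
  let ?C = "A 1 \<union> A 2 \<union> A k" and ?U = "A' (k - 1) \<union> A' k"
  have disj: "disjoint_family_on A {1..k}" and disj': "disjoint_family_on A' {1..k}"
    using parts_A A' by (auto simp: parts_of_sizes_def)
  have V: "(\<Union>i\<in>{1..k}. A i) = (\<Union>i\<in>{1..k}. A' i)"
    using G' by (simp add: G_def replace_on_def)
  have ks: "1 \<in> {1..k}" "2 \<in> {1..k}" "k \<in> {1..k}" "k - 1 \<in> {1..k}"
    using k by auto
  have finA: "finite (A i)" for i by (simp add: A_def)
  have "card ?C = card (A 1) + card (A 2) + card (A k)"
    using k disjoint_family_onD[OF disj ks(1,2)] disjoint_family_onD[OF disj ks(1,3)]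
      disjoint_family_onD[OF disj ks(2,3)] finA
    by (simp add: card_Un_disjoint Int_Un_distrib2)
  moreover have "a 1 = p" "a 2 = p" "a k = c" using k by (auto simp: a_def)
  ultimately have cardC: "card ?C = 2 * p + c" by (simp add: A_def)
  have "card ?U \<le> card (A' (k - 1)) + card (A' k)"
    by (rule card_Un_le)
  then have cardU: "card ?U \<le> p + c" "finite ?U"
    using A' ks k by (auto simp: parts_of_sizes_def a_simps)
  have "\<not> ?C \<subseteq> ?U"
  proof
    assume "?C \<subseteq> ?U"
    then have "2 * p + c \<le> p + c" using card_mono[OF cardU(2), of ?C] cardC cardU by simp
    then show False using c by (simp add: p_def)
  qed
  then obtain z where z: "z \<in> ?C" "z \<notin> ?U" by blast
  then have "z \<in> (\<Union>i\<in>{1..k}. A' i)" using V ks by blast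
  then obtain i where i: "i \<in> {1..k}" "z \<in> A' i" by blast
  then have "i \<noteq> k" "i \<noteq> k - 1" using z by auto
  \<comment> \<open>Since \<open>A' i\<close> is not among the replaced parts, its vertices are
    adjacent to everything outside it, so non-neighbours stay inside.\<close>
  have nonadj: "v' \<in> A' i" if v: "v \<in> A' i" "v' \<in> ?C" "{v, v'} \<notin> edges G" for v v'
  proof -
    have "v' \<in> (\<Union>i\<in>{1..k}. A' i)" using V ks v by blast
    then obtain j where j: "j \<in> {1..k}" "v' \<in> A' j" by blast
    have "\<not> {v, v'} \<subseteq> ?U"
      using v(1) disjoint_family_onD[OF disj' i(1), of k] disjoint_family_onD[OF disj' i(1), of "k - 1"]
        ks \<open>i \<noteq> k\<close> \<open>i \<noteq> k - 1\<close> by blast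
    then have "{v, v'} \<notin> edges (complete_multipartite k A')"
      using v(3) by (auto simp: G' replace_on_def)
    then have "i = j"
      using edge_complete_multipartite_iff[OF disj' i(1) j(1) v(1) j(2)] by simp
    then show ?thesis using j by simp
  qed
  \<comment> \<open>Each \<open>A j\<close> is independent in \<open>G\<close>, so one vertex of it
    in \<open>A' i\<close> draws in all the others.\<close>
  have part: "A j \<subseteq> A' i" if "v \<in> A j" "v \<in> A' i" "j \<in> {1, 2, k}" for v j
  proof
    fix v' assume v': "v' \<in> A j"
    then have "{v, v'} \<notin> edges G"
      using edge_complete_multipartite_iff[OF disj, of j j v v'] that ks by (auto simp: G_def)
    moreover have "v' \<in> ?C" using v' that(3) by blast
    ultimately show "v' \<in> A' i" using nonadj that(2) by blast
  qed
  have R: "{k * p, 1 * p} \<notin> edges G" "{1 * p, k * p} \<notin> edges G"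
    "{k * p + 1, 2 * p} \<notin> edges G" "{2 * p, k * p + 1} \<notin> edges G"
    by (auto simp: G_def R_def insert_commute)
  have k1: "A 1 \<subseteq> A' i \<Longrightarrow> A k \<subseteq> A' i"
    using nonadj[OF _ _ R(2)] part[of "k * p" k] mem_A by blast
  \<comment> \<open>From whichever of the three parts contains \<open>z\<close>, a deleted edge
    leads to \<open>A k\<close> if necessary; from there both deleted edges lead on to
    \<open>A 1\<close> and \<open>A 2\<close>.\<close>
  have "A k \<subseteq> A' i"
  proof -
    consider "z \<in> A 1" | "z \<in> A 2" | "z \<in> A k" using z by blast
    then show ?thesis
    proof cases
      case 1
      then show ?thesis using k1 part[of z 1] i by blast
    next
      case 2
      then have "A 2 \<subseteq> A' i" using part[of z 2] i by blast
      then show ?thesis using nonadj[OF _ _ R(4)] part[of "k * p + 1" k] mem_A by blast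
    next
      case 3
      then show ?thesis using part[of z k] i by blast
    qed
  qed
  then have "?C \<subseteq> A' i"
    using nonadj[OF _ _ R(1)] nonadj[OF _ _ R(3)] part[of "1 * p" 1] part[of "2 * p" 2] mem_A by blast
  moreover have "finite (A' i)" "card (A' i) = p"
    using A' i \<open>i \<noteq> k\<close> by (auto simp: parts_of_sizes_def a_def)
  ultimately have "2 * p + c \<le> p"
    using card_mono[of "A' i" ?C] cardC by linarith
  then show False using c by simp
qed

text \<open>Each part size is at most its square, so the sum of squares is at least
  \<open>n\<close>, and \<open>2 * e\<close> is at most \<open>n^2 - n\<close>.\<close>

lemma e_le_choose: "e \<le> n choose 2"
proof -
  have "int x \<le> (int x)\<^sup>2" for x
    by (cases x) (auto simp: power2_eq_square algebra_simps)
  then have "(int k - 1) * (int p)\<^sup>2 + (int c)\<^sup>2 \<ge> int n"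
    unfolding int_n using k by (intro add_mono mult_left_mono) auto
  then show ?thesis using two_e two_choose_two[of n] by (simp add: power2_eq_square algebra_simps)
qed

lemma H2star_minus_H1star_nonempty:
  "n \<ge> 1 \<and> e \<ge> 1 \<and> turan_number (k - 1) n < e \<and> e \<le> n choose 2 \<and>
     (H2star n e :: nat ugraph set) - H1star n e \<noteq> {}"
proof -
  have "turan_number (k - 1) n < e" using k by (intro turan_number_less) auto
  moreover have "G \<in> H2star n e - H1star n e"
    using G_in_H2_removal G_not_in_H1star by (auto simp: H2star_def)
  ultimately show ?thesis
    using n_ge e_le_choose by auto
qed

end

section \<open>Assembling the two claims\<close>

lemma k_of_ge_2:
  assumes n: "n \<ge> 1" and e: "0 < e" "e \<le> n choose 2"
  shows "k_of n e \<ge> 2"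
proof -
  have "1 \<le> k_of n e \<and> e \<le> turan_number (k_of n e) n"
    \<comment> \<open>The witness \<open>s = n\<close> works because \<open>T_n(n)\<close> is
      complete.\<close>
    unfolding k_of_def by (rule LeastI[of _ n]) (use n e turan_number_self in simp)
  moreover have "turan_number 1 n = 0"
    using turan_number_le[of 1 n] by simp
  ultimately show ?thesis
    using e by (cases "k_of n e = 1") auto
qed

theorem proposition1p2:
  shows "(\<forall>n r e :: nat. n \<ge> r \<and> r \<ge> 4 \<and> turan_number (r - 1) n < e \<and> e \<le> n choose 2 \<longrightarrow>
            (\<forall>G \<in> (H2star n e :: 'a ugraph set). int (clique_count r G) = hstar r n e)) \<and>
         (\<forall>r :: nat. r \<ge> 4 \<longrightarrow>
            infinite {(n :: nat, e :: nat). n \<ge> 1 \<and> e \<ge> 1 \<and>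
              turan_number (r - 1) n < e \<and> e \<le> n choose 2 \<and>
              (H2star n e :: nat ugraph set) - H1star n e \<noteq> {}})"
proof (intro conjI allI impI ballI)
  fix n r e :: nat and G :: "'a ugraph"
  assume *: "n \<ge> r \<and> r \<ge> 4 \<and> turan_number (r - 1) n < e \<and> e \<le> n choose 2"
    and "G \<in> H2star n e"
  then show "int (clique_count r G) = hstar r n e"
    using k_of_ge_2[of n e] by (intro clique_count_H2star) auto
next
  fix r :: nat assume r: "r \<ge> 4"
  let ?S = "{(n :: nat, e :: nat). n \<ge> 1 \<and> e \<ge> 1 \<and>
              turan_number (r - 1) n < e \<and> e \<le> n choose 2 \<and>
              (H2star n e :: nat ugraph set) - H1star n e \<noteq> {}}"
  \<comment> \<open>These are the vertex numbers of the examples with \<open>k = r\<close>; the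
    shift by 2 meets the requirement on \<open>c\<close> in the locale. They are distinct for
    distinct \<open>c\<close>, so infinitely many first coordinates occur.\<close>
  let ?f = "\<lambda>c. r * ((c + 2) + r - 1)"
  have "?f c \<in> fst ` ?S" for c
  proof -
    interpret equal_parts_but_one r "c + 2" by unfold_locales (use r in auto)
    have "(n, e) \<in> ?S" using H2star_minus_H1star_nonempty by simp
    then have "fst (n, e) \<in> fst ` ?S" by (rule imageI)
    then show ?thesis by (simp only: fst_conv n_eq)
  qed
  then have "range ?f \<subseteq> fst ` ?S" by blast
  moreover have "infinite (range ?f)"
    using r by (intro range_inj_infinite injI) simp
  ultimately show "infinite ?S"
    by (meson finite_imageI finite_subset)
qed

end
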